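(* Let $\mu$ be a continuous (i.e. atomless) probability measure on $\mathbb{R}_+=[0,\infty)$ and $r\in(0,1)$. Let $\nu_\infty$ be the almost sure weak limit of the empirical distributions $\nu_t^*$ of the quantile admission process with veto power with parameters $\mu,r$. Then, almost surely, either $\nu_\infty=\delta_{\mu_{\max}}$, or there is $m<\mu_{\max}$ with $\rho(m)=0$ such that $$d\nu_\infty(x)\ \propto\ \mu\big([x,\infty)\cap[2m-x,\infty)\big)\,d\mu(x).$$
   Context: Process. Let $(X_t,Y_t)_{t\ge 1}$ be independent pairs of independent $\mu$-distributed random variables. Let $\mathcal{S}_0=\emptyset$, a multiset of reals. For $t\ge1$: if $\#\{s\in\mathcal{S}_{t-1}: s\le \frac{X_t+Y_t}{2}\}\ge r|\mathcal{S}_{t-1}|$ (counted with multiplicity), then $\mathcal{S}_t$ is $\mathcal{S}_{t-1}$ with one additional copy of $\min(X_t,Y_t)$; otherwise $\mathcal{S}_t=\mathcal{S}_{t-1}$. For $t\ge 1$ put $\nu^*_t=\frac{1}{|\mathcal{S}_t|}\sum_{s\in\mathcal{S}_t}\delta_s$. It is known that for every probability measure $\mu$ on $\mathbb{R}_+$ and $r\in(0,1)$, $\nu^*_t$ converges weakly almost surely to a (possibly random) probability measure $\nu_\infty$. Notation. $\mu_{\max}\in[0,\infty]$ is the supremum of the support of $\mu$; for real $m<\mu_{\max}$, $\rho(m)=\frac{\mu((m,\infty))^2}{(\mu*\mu)([2m,\infty))}-(1-r)$. The alternative $\nu_\infty=\delta_{\mu_{\max}}$ is possible only if $\mu_{\max}<\infty$.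 *)

theory Defs
  imports "HOL-Probability.Probability"
begin

text \<open>
  The multiset of admitted values after \<open>t\<close> steps, driven by the realized pairs
  \<open>(x 1, y 1), (x 2, y 2), \<dots>\<close>; the values \<open>x 0\<close> and \<open>y 0\<close> are never used.
\<close>
primrec admitted :: "real \<Rightarrow> (nat \<Rightarrow> real) \<Rightarrow> (nat \<Rightarrow> real) \<Rightarrow> nat \<Rightarrow> real multiset" where
  "admitted r x y 0 = {#}"
| "admitted r x y (Suc t) =
     (let S = admitted r x y t in
      if real (size {#s \<in># S. s \<le> (x (Suc t) + y (Suc t)) / 2#}) \<ge> r * real (size S)
      then add_mset (min (x (Suc t)) (y (Suc t))) S
      else S)"

lemma admitted_nonempty: "t \<ge> 1 \<Longrightarrow> admitted r x y t \<noteq> {#}"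
proof (induction t)
  case (Suc t)
  then show ?case by (cases t) (auto simp: Let_def)
qed simp

text \<open>
  The normalized sum of Dirac measures over a multiset, as a Borel measure: the discrete
  \<open>\<sigma>\<close>-algebra carried by a \<open>pmf\<close> is replaced by the Borel one. Meaningful only for \<open>S \<noteq> {#}\<close>.
\<close>
definition empirical_measure :: "real multiset \<Rightarrow> real measure" where
  "empirical_measure S = distr (measure_pmf (pmf_of_multiset S)) borel (\<lambda>s. s)"

lemma measure_empirical_measure:
  assumes "S \<noteq> {#}" and "A \<in> sets borel"
  shows "measure (empirical_measure S) A = real (size {#s \<in># S. s \<in> A#}) / real (size S)"
proof -
  have "measure (empirical_measure S) A = measure (measure_pmf (pmf_of_multiset S)) A"
    unfolding empirical_measure_def using assms(2) by (subst measure_distr) auto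
  also have "\<dots> = measure (measure_pmf (pmf_of_multiset S)) (A \<inter> set_pmf (pmf_of_multiset S))"
    by (simp add: measure_Int_set_pmf)
  also have "\<dots> = (\<Sum>s\<in>A \<inter> set_mset S. real (count S s) / real (size S))"
    using assms(1) by (subst measure_measure_pmf_finite) auto
  also have "\<dots> = real (\<Sum>s\<in>A \<inter> set_mset S. count S s) / real (size S)"
    by (simp add: sum_divide_distrib)
  also have "(\<Sum>s\<in>A \<inter> set_mset S. count S s) = size {#s \<in># S. s \<in> A#}"
    by (auto simp: size_multiset_overloaded_eq intro!: sum.cong)
  finally show ?thesis .
qed

definition measure_support :: "real measure \<Rightarrow> real set" where
  "measure_support \<mu> = {x. \<forall>U. open U \<and> x \<in> U \<longrightarrow> emeasure \<mu> U > 0}"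

definition mu_max :: "real measure \<Rightarrow> ereal" where
  "mu_max \<mu> = (SUP x\<in>measure_support \<mu>. ereal x)"

definition rho :: "real measure \<Rightarrow> real \<Rightarrow> real \<Rightarrow> real" where
  "rho \<mu> r m = (measure \<mu> {m<..})\<^sup>2 / measure (\<mu> \<star> \<mu>) {2 * m..} - (1 - r)"

end

theory Submission
  imports Defs
begin

text \<open>
  The acceptance rule compares the mean \<open>(X + Y) / 2\<close> with a bar: the smallest \<open>q\<close> such that a
  share of at least \<open>r\<close> of the current multiset lies at or below \<open>q\<close>. If the bar were
  constantly \<open>m\<close>, the law of large numbers would give the law of \<open>min X Y\<close> conditioned on
  \<open>X + Y \<ge> 2 * m\<close> as the limit. Its density with respect to \<open>\<mu>\<close> at \<open>x\<close> is proportional to the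
  probability that an independent partner is at least \<open>x\<close> and at least \<open>2 * m - x\<close>
  (\<open>pass_law\<close>). The condition that \<open>m\<close> is an \<open>r\<close>-quantile of this law is \<open>rho m = 0\<close>, because
  the minimum exceeds \<open>m\<close> exactly if both values do, and then the pair passes. It therefore suffices
  that the decisions agree with those of a constant bar \<open>m\<close>, up to a vanishing share of
  the steps (\<open>limit_law\<close>).

  Weak convergence to \<open>\<nu>\<close> confines the bar asymptotically to the interval \<open>[a, b]\<close> of
  \<open>r\<close>-quantiles of \<open>\<nu>\<close>. If \<open>a = b\<close>, the bar converges to \<open>b\<close>, and \<open>m = b\<close> unless
  \<open>b = mu_max\<close>. If \<open>a < b\<close>, the open interval
  carries no mass of \<open>\<nu>\<close>, and there are two cases.

  First, let \<open>\<mu>\<close> have a support point \<open>z\<close> between \<open>a\<close> and \<open>b\<close>. Whenever the bar is at or below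
  \<open>z\<close>, there is a fixed positive chance that a pair is admitted whose minimum lies close to \<open>z\<close>. Since
  \<open>\<nu>\<close> puts no mass there, the bar must be above \<open>z\<close> at all but a negligible number of steps.
  As the bar takes values in the support only, this leaves \<open>b\<close> as its essential limit (\<open>bar_rare_below_qhigh\<close>).

  Secondly, let the support avoid \<open>(a, b)\<close>. Then the bar jumps between the two ends according to the
  sign of \<open>W = #{s \<le> q} - r * #S\<close>, where \<open>a < q < b\<close>. The expected increment of \<open>W\<close> is
  some \<open>h a\<close> while the bar is at \<open>a\<close> (where \<open>W \<ge> 0\<close>) and some \<open>h b \<le> h a\<close> while it is at \<open>b\<close>
  (where \<open>W < 0\<close>), and convergence forces \<open>W\<close> to be negligible. An outward drift on one side would
  drive \<open>\<bar>W\<bar>\<close> to a positive multiple of the time spent there, so \<open>h a > 0\<close> makes the low bar rare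
  and \<open>h b < 0\<close> makes the high bar rare. In the remaining case \<open>h a = h b = 0\<close> the two bars make the
  same decisions almost surely (\<open>threshold_across_gap\<close>).

  If the bar tends to \<open>b = mu_max\<close>, then an admitted minimum \<open>s\<close> satisfies
  \<open>s + mu_max > 2 * bar\<close>, so it tends to \<open>mu_max\<close> as well and \<open>\<nu>\<close> is the Dirac measure
  (\<open>limit_at_mu_max\<close>). The admissions may then be sublinear in time. This is why the
  probabilistic input, \<open>predictable_selection_law_of_large_numbers\<close>, measures time by the number of
  selected steps; it is used for countably many selections, and the rest of the argument is
  deterministic.
\<close>

section \<open>Counting the occurrences of an event\<close>

definition hits :: "(nat \<Rightarrow> bool) \<Rightarrow> nat \<Rightarrow> real" where
  "hits P t = (\<Sum>i<t. of_bool (P i))"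

lemma hits_0 [simp]: "hits P 0 = 0"
  and hits_Suc [simp]: "hits P (Suc t) = hits P t + of_bool (P t)"
  by (simp_all add: hits_def)

lemma hits_nonneg [simp]: "0 \<le> hits P t"
  by (simp add: hits_def sum_nonneg)

lemma hits_mono: "(\<And>i. i < t \<Longrightarrow> P i \<Longrightarrow> Q i) \<Longrightarrow> hits P t \<le> hits Q t"
  unfolding hits_def by (rule sum_mono) auto

lemma hits_le_add:
  assumes "\<And>i. i < t \<Longrightarrow> P i \<Longrightarrow> Q i \<or> R i"
  shows "hits P t \<le> hits Q t + hits R t"
  unfolding hits_def sum.distrib[symmetric] using assms by (intro sum_mono) auto

lemma mono_hits: "mono (hits P)"
  by (simp add: mono_iff_le_Suc)

lemma hits_le: "hits P t \<le> real t"
  by (induction t) (auto simp: of_bool_def)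

lemma hits_natural: "\<exists>k. hits P t = real k"
proof (induction t)
  case (Suc t)
  then obtain k where "hits P t = real k" by auto
  then show ?case by (intro exI[of _ "k + of_bool (P t)"]) simp
qed (simp add: exI[of _ 0])

lemma hits_bounded_or_at_top:
  "(\<exists>B. \<forall>t. hits P t \<le> B) \<or> filterlim (hits P) at_top sequentially"
proof (cases "\<exists>B. \<forall>t. hits P t \<le> B")
  case False
  then have "\<exists>t0. \<forall>t\<ge>t0. B \<le> hits P t" for B
    using mono_hits[of P] by (metis linorder_le_cases monoD order_trans)
  then show ?thesis by (auto simp: filterlim_at_top eventually_sequentially)
qed simp

section \<open>A law of large numbers for predictable selections\<close>

text \<open>
  An adapted functional is a function on whole sequences that reads only the entries \<open>1, \<dots>, n\<close>. This
  form makes sums and products of functionals with different \<open>n\<close> well-typed, while the product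
  \<open>\<sigma>\<close>-algebra over \<open>{1..n}\<close> is still the one that independence speaks about.
\<close>
definition adapted :: "'b measure \<Rightarrow> nat \<Rightarrow> ((nat \<Rightarrow> 'b) \<Rightarrow> real) \<Rightarrow> bool" where
  "adapted N n \<Phi> \<longleftrightarrow>
     \<Phi> \<in> borel_measurable (PiM {1..n} (\<lambda>_. N)) \<and> (\<forall>z. \<Phi> (restrict z {1..n}) = \<Phi> z)"

lemma adapted_mono:
  assumes "adapted N n \<Phi>" "n \<le> m"
  shows "adapted N m \<Phi>"
proof -
  have sub: "{1..n} \<subseteq> {1..m}" using assms(2) by auto
  have r: "\<Phi> (restrict z {1..n}) = \<Phi> z" for z using assms(1) unfolding adapted_def by blast
  have "(\<lambda>z. \<Phi> (restrict z {1..n})) \<in> borel_measurable (PiM {1..m} (\<lambda>_. N))"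
    using assms(1) sub unfolding adapted_def
    by (intro measurable_compose[OF measurable_restrict_subset[OF sub]]) auto
  moreover have "\<Phi> (restrict z {1..m}) = \<Phi> z" for z
  proof -
    have "restrict (restrict z {1..m}) {1..n} = restrict z {1..n}"
      using sub by (auto simp: fun_eq_iff restrict_def)
    then show ?thesis using r by metis
  qed
  ultimately show ?thesis unfolding adapted_def r by blast
qed

lemma adapted_const [simp]: "adapted N n (\<lambda>_. c)"
  by (simp add: adapted_def)

lemma adapted_mult:
  "adapted N n \<Phi> \<Longrightarrow> adapted N n \<Psi> \<Longrightarrow> adapted N n (\<lambda>z. \<Phi> z * \<Psi> z)"
  by (auto simp: adapted_def)

lemma adapted_sum:
  "(\<And>i. i \<in> I \<Longrightarrow> adapted N n (\<Phi> i)) \<Longrightarrow> adapted N n (\<lambda>z. \<Sum>i\<in>I. \<Phi> i z)"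
  by (auto simp: adapted_def intro!: borel_measurable_sum sum.cong)

lemma adapted_comp:
  "f \<in> borel_measurable borel \<Longrightarrow> adapted N n \<Phi> \<Longrightarrow> adapted N n (\<lambda>z. f (\<Phi> z))"
  by (auto simp: adapted_def)

lemma adapted_coordinate:
  assumes "f \<in> borel_measurable N" "1 \<le> k" "k \<le> n"
  shows "adapted N n (\<lambda>z. f (z k))"
  using assms by (auto simp: adapted_def intro!: measurable_compose[OF measurable_component_singleton])

lemma adapted_selected_sum:
  assumes K: "\<And>i. adapted N i (\<lambda>z. of_bool (K i z))" and f: "f \<in> borel_measurable N"
  shows "adapted N n (\<lambda>z. \<Sum>i<n. of_bool (K i z) * f (z (Suc i)))"
proof (intro adapted_sum adapted_mult)
  fix i assume i: "i \<in> {..<n}"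
  show "adapted N n (\<lambda>z. of_bool (K i z))" using adapted_mono[OF K[of i], of n] i by auto
  show "adapted N n (\<lambda>z. f (z (Suc i)))" using i f by (intro adapted_coordinate) auto
qed

lemma abs_selected_sum_le:
  fixes f :: "'b \<Rightarrow> real"
  assumes "\<And>u. \<bar>f u\<bar> \<le> 1"
  shows "\<bar>\<Sum>i<n. of_bool (K i z) * f (z (Suc i))\<bar> \<le> real n"
proof -
  have "\<bar>\<Sum>i<n. of_bool (K i z) * f (z (Suc i))\<bar> \<le> (\<Sum>i<n. \<bar>of_bool (K i z) * f (z (Suc i))\<bar>)"
    by (rule sum_abs)
  also have "\<dots> \<le> (\<Sum>i<n. 1)" using assms by (intro sum_mono) (auto simp: abs_mult)
  finally show ?thesis by simp
qed

context prob_space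
begin

lemma adapted_measurable:
  assumes "indep_vars (\<lambda>_. N) Z {1..}" "adapted N n \<Phi>"
  shows "(\<lambda>\<omega>. \<Phi> (\<lambda>k. Z k \<omega>)) \<in> borel_measurable M"
proof -
  have "(\<lambda>\<omega>. restrict (\<lambda>k. Z k \<omega>) {1..n}) \<in> measurable M (PiM {1..n} (\<lambda>_. N))"
    using assms(1) by (auto simp: indep_vars_def intro!: measurable_restrict)
  from measurable_compose[OF this, of \<Phi> borel]
  show ?thesis using assms(2) by (simp add: adapted_def)
qed

lemma adapted_orthogonal:
  assumes ind: "indep_vars (\<lambda>_. N) Z {1..}"
    and \<Phi>: "adapted N n \<Phi>" "\<And>z. \<bar>\<Phi> z\<bar> \<le> B"
    and f: "f \<in> borel_measurable N" "\<And>u. \<bar>f u\<bar> \<le> C" "expectation (\<lambda>\<omega>. f (Z (Suc n) \<omega>)) = 0"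
  shows "expectation (\<lambda>\<omega>. \<Phi> (\<lambda>k. Z k \<omega>) * f (Z (Suc n) \<omega>)) = 0"
proof -
  have "indep_var (PiM {1..n} (\<lambda>_. N)) (\<lambda>\<omega>. restrict (\<lambda>k. Z k \<omega>) {1..n})
                  (PiM {Suc n} (\<lambda>_. N)) (\<lambda>\<omega>. restrict (\<lambda>k. Z k \<omega>) {Suc n})"
    by (rule indep_var_restrict[OF ind]) auto
  then have "indep_var borel (\<Phi> \<circ> (\<lambda>\<omega>. restrict (\<lambda>k. Z k \<omega>) {1..n}))
                  borel ((\<lambda>z. f (z (Suc n))) \<circ> (\<lambda>\<omega>. restrict (\<lambda>k. Z k \<omega>) {Suc n}))"
    using \<Phi>(1) f(1) by (intro indep_var_compose) (auto simp: adapted_def)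
  moreover have "\<Phi> \<circ> (\<lambda>\<omega>. restrict (\<lambda>k. Z k \<omega>) {1..n}) = (\<lambda>\<omega>. \<Phi> (\<lambda>k. Z k \<omega>))"
    using \<Phi>(1) by (auto simp: adapted_def)
  ultimately have iv: "indep_var borel (\<lambda>\<omega>. \<Phi> (\<lambda>k. Z k \<omega>)) borel (\<lambda>\<omega>. f (Z (Suc n) \<omega>))"
    by (simp add: comp_def)
  have "integrable M (\<lambda>\<omega>. \<Phi> (\<lambda>k. Z k \<omega>))"
    using \<Phi> indep_var_rv1[OF iv] by (intro integrable_const_bound[where B=B]) auto
  moreover have "integrable M (\<lambda>\<omega>. f (Z (Suc n) \<omega>))"
    using f indep_var_rv2[OF iv] by (intro integrable_const_bound[where B=C]) auto
  ultimately show ?thesis using indep_var_lebesgue_integral[OF iv] f(3) by simp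
qed

text \<open>
  The summands are orthogonal because whether a step is selected depends only on the past. The
  bound \<open>k\<close> on the number of selections replaces the number \<open>n\<close> of steps, which makes the estimate uniform
  in \<open>n\<close>.
\<close>
lemma selected_sum_second_moment:
  assumes ind: "indep_vars (\<lambda>_. N) Z {1..}"
    and K: "\<And>i. adapted N i (\<lambda>z. of_bool (K i z))"
    and few: "\<And>z n. hits (\<lambda>i. K i z) n \<le> k"
    and f: "f \<in> borel_measurable N" "\<And>u. \<bar>f u\<bar> \<le> 1" "\<And>n. expectation (\<lambda>\<omega>. f (Z (Suc n) \<omega>)) = 0"
  defines "S \<equiv> \<lambda>n z. \<Sum>i<n. of_bool (K i z) * f (z (Suc i))"
  shows "expectation (\<lambda>\<omega>. (S n (\<lambda>k. Z k \<omega>))\<^sup>2) \<le> k"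
proof -
  have adS: "adapted N n (S n)" for n
    unfolding S_def by (rule adapted_selected_sum[OF K f(1)])
  have bS: "\<bar>S n z\<bar> \<le> real n" for n z
    unfolding S_def by (rule abs_selected_sum_le[OF f(2)])
  note mS = adapted_measurable[OF ind adS]
  have bS2: "(S n z)\<^sup>2 \<le> (real n)\<^sup>2" for n z
    using power_mono[OF bS[of n z], of 2] by simp
  have iS: "integrable M (\<lambda>\<omega>. (S n (\<lambda>k. Z k \<omega>))\<^sup>2)" for n
    using bS2 mS by (intro integrable_const_bound[where B="(real n)\<^sup>2"]) auto
  have mK: "(\<lambda>\<omega>. of_bool (K i (\<lambda>k. Z k \<omega>)) :: real) \<in> borel_measurable M" for i
    using adapted_measurable[OF ind K[of i]] .
  have iK: "integrable M (\<lambda>\<omega>. of_bool (K i (\<lambda>k. Z k \<omega>)) :: real)" for i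
    using mK by (intro integrable_const_bound[where B=1]) auto
  have mf: "(\<lambda>\<omega>. f (Z (Suc i) \<omega>)) \<in> borel_measurable M" for i
  proof -
    have "adapted N (Suc i) (\<lambda>z. f (z (Suc i)))" using f(1) by (intro adapted_coordinate) auto
    from adapted_measurable[OF ind this] show ?thesis .
  qed
  have step: "expectation (\<lambda>\<omega>. (S (Suc n) (\<lambda>k. Z k \<omega>))\<^sup>2)
      \<le> expectation (\<lambda>\<omega>. (S n (\<lambda>k. Z k \<omega>))\<^sup>2) + expectation (\<lambda>\<omega>. of_bool (K n (\<lambda>k. Z k \<omega>)))" for n
  proof -
    let ?c = "\<lambda>\<omega>. (2 * S n (\<lambda>k. Z k \<omega>) * of_bool (K n (\<lambda>k. Z k \<omega>))) * f (Z (Suc n) \<omega>)"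
    have ad: "adapted N n (\<lambda>z. 2 * S n z * of_bool (K n z))"
      using adS K by (intro adapted_mult adapted_const) auto
    have bd: "\<bar>2 * S n z * of_bool (K n z)\<bar> \<le> 2 * real n" for z
      using bS[of n z] by (auto simp: abs_mult)
    have c0: "expectation ?c = 0"
      by (rule adapted_orthogonal[OF ind ad bd f])
    have ic: "integrable M ?c"
    proof (intro integrable_const_bound[where B="2 * real n"] AE_I2)
      fix \<omega>
      show "norm (?c \<omega>) \<le> 2 * real n"
        using mult_mono[OF bd[of "\<lambda>k. Z k \<omega>"] f(2)[of "Z (Suc n) \<omega>"]] by (simp add: abs_mult)
    qed (use adapted_measurable[OF ind ad] mf in auto)
    have "expectation (\<lambda>\<omega>. (S (Suc n) (\<lambda>k. Z k \<omega>))\<^sup>2)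
        \<le> expectation (\<lambda>\<omega>. ((S n (\<lambda>k. Z k \<omega>))\<^sup>2 + of_bool (K n (\<lambda>k. Z k \<omega>))) + ?c \<omega>)"
    proof (rule integral_mono)
      show "integrable M (\<lambda>\<omega>. ((S n (\<lambda>k. Z k \<omega>))\<^sup>2 + of_bool (K n (\<lambda>k. Z k \<omega>))) + ?c \<omega>)"
        using iS iK ic by (intro Bochner_Integration.integrable_add) auto
      fix \<omega>
      have "(f (Z (Suc n) \<omega>))\<^sup>2 \<le> 1" using power_mono[OF f(2)[of "Z (Suc n) \<omega>"], of 2] by simp
      moreover have "S (Suc n) z = S n z + of_bool (K n z) * f (z (Suc n))" for z
        by (simp only: S_def sum.lessThan_Suc)
      moreover have "(a + of_bool b * c)\<^sup>2 \<le> a\<^sup>2 + of_bool b + (2 * a * of_bool b) * c" if "c\<^sup>2 \<le> 1" for a c :: real and b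
        using that by (cases b) (simp_all add: power2_sum)
      ultimately show "(S (Suc n) (\<lambda>k. Z k \<omega>))\<^sup>2 \<le>
          (S n (\<lambda>k. Z k \<omega>))\<^sup>2 + of_bool (K n (\<lambda>k. Z k \<omega>)) + ?c \<omega>"
        by (simp only:)
    qed (rule iS)
    also have "\<dots> = expectation (\<lambda>\<omega>. (S n (\<lambda>k. Z k \<omega>))\<^sup>2) + expectation (\<lambda>\<omega>. of_bool (K n (\<lambda>k. Z k \<omega>)))"
      unfolding Bochner_Integration.integral_add[OF Bochner_Integration.integrable_add[OF iS iK] ic]
        Bochner_Integration.integral_add[OF iS iK] c0 by simp
    finally show ?thesis .
  qed
  have "expectation (\<lambda>\<omega>. (S n (\<lambda>k. Z k \<omega>))\<^sup>2) \<le> (\<Sum>i<n. expectation (\<lambda>\<omega>. of_bool (K i (\<lambda>k. Z k \<omega>))))"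
  proof (induction n)
    case 0
    show ?case unfolding S_def by simp
  next
    case (Suc n)
    show ?case unfolding sum.lessThan_Suc
      by (rule order_trans[OF step]) (rule add_right_mono[OF Suc.IH])
  qed
  also have "\<dots> = expectation (\<lambda>\<omega>. hits (\<lambda>i. K i (\<lambda>k. Z k \<omega>)) n)"
    unfolding hits_def using iK by (intro Bochner_Integration.integral_sum[symmetric])
  also have "\<dots> \<le> expectation (\<lambda>_. k)"
  proof (rule integral_mono)
    show "integrable M (\<lambda>\<omega>. hits (\<lambda>i. K i (\<lambda>k. Z k \<omega>)) n)"
      unfolding hits_def using iK by (intro Bochner_Integration.integrable_sum)
  qed (use few in auto)
  finally show ?thesis unfolding lebesgue_integral_const by (simp only: prob_space scaleR_one)
qed

text \<open>
  The fluctuation \<open>T\<close> is stopped when \<open>k\<close> steps have been selected, so its second moment is at most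
  \<open>k\<close>, however long it takes to select them. Along \<open>k = j\<^sup>2\<close> the normalised second moments
  \<open>j\<^sup>2 / j\<^sup>4\<close> are summable, which gives almost sure convergence along the squares. Between two
  squares \<open>T\<close> moves by at most the number \<open>2 * j\<close> of further selections, which is of lower order than
  \<open>j\<^sup>2\<close>.
\<close>
lemma predictable_selection_law_of_large_numbers:
  assumes ind: "indep_vars (\<lambda>_. N) Z {1..}"
    and distr: "\<And>t. t \<ge> 1 \<Longrightarrow> distr M N (Z t) = \<pi>"
    and H: "\<And>i. adapted N i (\<lambda>z. of_bool (H i z))"
    and A: "A \<in> sets N"
  shows "AE \<omega> in M. filterlim (hits (\<lambda>i. H i (\<lambda>k. Z k \<omega>))) at_top sequentially \<longrightarrow>
     (\<lambda>t. hits (\<lambda>i. H i (\<lambda>k. Z k \<omega>) \<and> Z (Suc i) \<omega> \<in> A) t / hits (\<lambda>i. H i (\<lambda>k. Z k \<omega>)) t)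
       \<longlonglongrightarrow> measure \<pi> A"
proof -
  define f where "f u = indicator A u - measure \<pi> A" for u
  have rv: "random_variable N (Z t)" if "t \<ge> 1" for t
    using ind that by (auto simp: indep_vars_def)
  have pr: "measure \<pi> A = prob (Z t -` A \<inter> space M)" if "t \<ge> 1" for t
    using distr[OF that] rv[OF that] A by (metis measure_distr)
  have pi01: "0 \<le> measure \<pi> A" "measure \<pi> A \<le> 1"
    using pr[of 1] by auto
  have fm: "f \<in> borel_measurable N" unfolding f_def using A by auto
  have fb: "\<bar>f u\<bar> \<le> 1" for u unfolding f_def using pi01 by (auto simp: indicator_def)
  have f0: "expectation (\<lambda>\<omega>. f (Z (Suc n) \<omega>)) = 0" for n
  proof -
    have "expectation (\<lambda>\<omega>. f (Z (Suc n) \<omega>)) =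
      expectation (\<lambda>\<omega>. indicator (Z (Suc n) -` A \<inter> space M) \<omega> - measure \<pi> A)"
      by (rule Bochner_Integration.integral_cong) (auto simp: f_def indicator_def)
    also have "\<dots> = expectation (indicator (Z (Suc n) -` A \<inter> space M)) - expectation (\<lambda>_. measure \<pi> A)"
      using measurable_sets[OF rv A, of "Suc n"]
      by (intro Bochner_Integration.integral_diff) (auto intro!: integrable_real_indicator simp: emeasure_eq_measure)
    also have "\<dots> = 0"
      using pr[of "Suc n"] measurable_sets[OF rv A, of "Suc n"] by (simp add: prob_space)
    finally show ?thesis .
  qed
  define Nn where "Nn z t = hits (\<lambda>i. H i z) t" for z t
  define K where "K k i z \<longleftrightarrow> H i z \<and> Nn z i < k" for k :: real and i z
  define S where "S k n z = (\<Sum>i<n. of_bool (K k i z) * f (z (Suc i)))" for k n z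
  define T where "T n z = (\<Sum>i<n. of_bool (H i z) * f (z (Suc i)))" for n z
  have adK: "adapted N i (\<lambda>z. of_bool (K k i z))" for k i
  proof -
    have "adapted N i (\<lambda>z. Nn z i)" unfolding Nn_def hits_def
      by (intro adapted_sum adapted_mono[OF H]) auto
    then have "adapted N i (\<lambda>z. indicator {..<k} (Nn z i) :: real)"
      by (intro adapted_comp[where f="indicator {..<k}"]) auto
    then have "adapted N i (\<lambda>z. of_bool (H i z) * indicator {..<k} (Nn z i))"
      by (intro adapted_mult H)
    moreover have "of_bool (H i z) * indicator {..<k} (Nn z i) = (of_bool (K k i z) :: real)" for z
      by (simp add: K_def indicator_def)
    ultimately show ?thesis by simp
  qed
  have fewK: "hits (\<lambda>i. K (real k) i z) n \<le> real k" for k z n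
  proof (induction n)
    case (Suc n)
    have "hits (\<lambda>i. K (real k) i z) n \<le> Nn z n" unfolding Nn_def by (rule hits_mono) (auto simp: K_def)
    moreover obtain j where "hits (\<lambda>i. K (real k) i z) n = real j" using hits_natural by blast
    note j = this
    ultimately have "j < k" if "K (real k) n z" using that by (simp add: K_def flip: of_nat_less_iff)
    then have "real j + 1 \<le> real k" if "K (real k) n z" using that by (simp flip: of_nat_Suc)
    then show ?case using Suc j by simp
  qed simp
  have S2: "expectation (\<lambda>\<omega>. (S (real k) n (\<lambda>k. Z k \<omega>))\<^sup>2) \<le> real k" for k n
    unfolding S_def by (rule selected_sum_second_moment[OF ind adK fewK fm fb f0])
  have adS: "adapted N n (S k n)" for k n
    unfolding S_def by (rule adapted_selected_sum[OF adK fm])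
  note mS[measurable] = adapted_measurable[OF ind adS]
  have bS: "\<bar>S k n z\<bar> \<le> real n" for k n z
    unfolding S_def by (rule abs_selected_sum_le[OF fb])
  have bS2: "(S k n z)\<^sup>2 \<le> (real n)\<^sup>2" for k n z
    using power_mono[OF bS[of k n z], of 2] by simp
  \<comment> \<open>The number of selections may stay below \<open>j\<^sup>2\<close> forever, so the stopped sum is taken as a limit
    over all horizons \<open>n\<close>; the lower limit is what Fatou's lemma controls.\<close>
  define R where "R j \<omega> = liminf (\<lambda>n. ennreal ((S (real (j\<^sup>2)) n (\<lambda>k. Z k \<omega>))\<^sup>2)) / ennreal (real j ^ 4)" for j \<omega>
  have R_int: "(\<integral>\<^sup>+\<omega>. R j \<omega> \<partial>M) \<le> ennreal (1 / real j ^ 2)" if "j \<ge> 1" for j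
  proof -
    have "(\<integral>\<^sup>+\<omega>. liminf (\<lambda>n. ennreal ((S (real (j\<^sup>2)) n (\<lambda>k. Z k \<omega>))\<^sup>2)) \<partial>M)
        \<le> liminf (\<lambda>n. \<integral>\<^sup>+\<omega>. ennreal ((S (real (j\<^sup>2)) n (\<lambda>k. Z k \<omega>))\<^sup>2) \<partial>M)"
      by (rule nn_integral_liminf) simp
    also have "\<dots> \<le> ennreal (real (j\<^sup>2))"
    proof -
      have "(\<integral>\<^sup>+\<omega>. ennreal ((S (real (j\<^sup>2)) n (\<lambda>k. Z k \<omega>))\<^sup>2) \<partial>M) \<le> ennreal (real (j\<^sup>2))" for n
      proof -
        have "integrable M (\<lambda>\<omega>. (S (real (j\<^sup>2)) n (\<lambda>k. Z k \<omega>))\<^sup>2)"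
          using bS2 mS by (intro integrable_const_bound[where B="(real n)\<^sup>2"]) auto
        then show ?thesis using S2[of "j\<^sup>2" n] by (simp add: nn_integral_eq_integral ennreal_leI)
      qed
      then show ?thesis
        by (intro Liminf_le always_eventually) auto
    qed
    finally have le: "(\<integral>\<^sup>+\<omega>. liminf (\<lambda>n. ennreal ((S (real (j\<^sup>2)) n (\<lambda>k. Z k \<omega>))\<^sup>2)) \<partial>M)
        \<le> ennreal (real (j\<^sup>2))" .
    have "(\<integral>\<^sup>+\<omega>. R j \<omega> \<partial>M) = (\<integral>\<^sup>+\<omega>. liminf (\<lambda>n. ennreal ((S (real (j\<^sup>2)) n (\<lambda>k. Z k \<omega>))\<^sup>2)) \<partial>M) / ennreal (real j ^ 4)"
      unfolding R_def by (rule nn_integral_divide) simp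
    also have "\<dots> \<le> ennreal (real (j\<^sup>2)) / ennreal (real j ^ 4)"
      by (rule divide_right_mono_ennreal[OF le])
    also have "\<dots> = ennreal (1 / real j ^ 2)"
      using that by (subst divide_ennreal) (auto simp: field_simps power_eq_if)
    finally show ?thesis .
  qed
  have mR[measurable]: "R j \<in> borel_measurable M" for j unfolding R_def by simp
  have "(\<integral>\<^sup>+\<omega>. (\<Sum>j. R (Suc j) \<omega>) \<partial>M) = (\<Sum>j. \<integral>\<^sup>+\<omega>. R (Suc j) \<omega> \<partial>M)"
    by (rule nn_integral_suminf) simp
  also have "\<dots> \<le> (\<Sum>j. ennreal (1 / real (Suc j) ^ 2))"
    by (intro suminf_le R_int summableI) simp
  also have "\<dots> < \<infinity>"
  proof -
    have "summable (\<lambda>j. 1 / real (Suc j) ^ 2)"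
      using inverse_power_summable[of 2, where 'a=real] by (subst summable_Suc_iff) (simp add: inverse_eq_divide)
    then show ?thesis by (subst suminf_ennreal2) (auto simp: less_top)
  qed
  finally have "(\<integral>\<^sup>+\<omega>. (\<Sum>j. R (Suc j) \<omega>) \<partial>M) \<noteq> \<infinity>" by simp
  then have "AE \<omega> in M. (\<Sum>j. R (Suc j) \<omega>) \<noteq> \<infinity>"
    by (intro nn_integral_PInf_AE) auto
  then show ?thesis
  proof (elim AE_mp, intro AE_I2 impI)
    fix \<omega> assume "\<omega> \<in> space M" and fin: "(\<Sum>j. R (Suc j) \<omega>) \<noteq> \<infinity>"
      and inf: "filterlim (hits (\<lambda>i. H i (\<lambda>k. Z k \<omega>))) at_top sequentially"
    define z where "z = (\<lambda>k. Z k \<omega>)"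
    \<comment> \<open>Stopped after as many selections as have occurred before \<open>t\<close>, the sum no longer changes after \<open>t\<close>.\<close>
    have stopped: "S (Nn z t) n z = T t z" if "t \<le> n" for t n
    proof -
      have K: "K (Nn z t) i z \<longleftrightarrow> i < t \<and> H i z" for i
      proof (cases "i < t")
        case True
        then have "H i z \<Longrightarrow> Nn z i < Nn z t"
          using monoD[OF mono_hits[of "\<lambda>i. H i z"], of "Suc i" t] by (simp add: Nn_def)
        then show ?thesis using True by (auto simp: K_def)
      next
        case False
        then have "Nn z t \<le> Nn z i" unfolding Nn_def by (intro monoD[OF mono_hits]) simp
        then show ?thesis using False by (auto simp: K_def)
      qed
      have "S (Nn z t) n z = (\<Sum>i<n. if i < t then of_bool (H i z) * f (z (Suc i)) else 0)"
        unfolding S_def K by (intro sum.cong) auto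
      also have "\<dots> = T t z" unfolding T_def using that
        by (intro sum.mono_neutral_cong_right) auto
      finally show ?thesis .
    qed
    have "(\<lambda>j. R (Suc j) \<omega>) \<longlonglongrightarrow> 0"
    proof -
      obtain g where g: "\<And>j. R (Suc j) \<omega> = ennreal (g j)" "\<And>j. 0 \<le> g j"
      proof -
        have "R (Suc j) \<omega> \<noteq> \<infinity>" for j
        proof
          assume "R (Suc j) \<omega> = \<infinity>"
          moreover have "R (Suc j) \<omega> \<le> (\<Sum>j. R (Suc j) \<omega>)"
            using sum_le_suminf[of "\<lambda>j. R (Suc j) \<omega>" "{j}"] by simp
          ultimately show False using fin by (simp add: top_unique)
        qed
        then show thesis using that[of "\<lambda>j. enn2real (R (Suc j) \<omega>)"] by (simp add: less_top)
      qed
      have "summable g" using fin g by (intro summable_suminf_not_top) auto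
      then have "g \<longlonglongrightarrow> 0" by (rule summable_LIMSEQ_zero)
      then show ?thesis unfolding g by (metis ennreal_0 tendsto_ennrealI)
    qed
    then have R0: "(\<lambda>j. R j \<omega>) \<longlonglongrightarrow> 0" by (rule LIMSEQ_imp_Suc)
    have T_N: "\<bar>T t z - T t' z\<bar> \<le> Nn z t - Nn z t'" if "t' \<le> t" for t t'
      using that
    proof (induction rule: dec_induct)
      case (step n)
      then show ?case using fb[of "z (Suc n)"] by (auto simp: T_def Nn_def)
    qed simp
    have reach: "\<exists>t'\<le>t. Nn z t' = real k" if "real k \<le> Nn z t" for k t
      using that
    proof (induction t)
      case (Suc t)
      show ?case
      proof (cases "real k \<le> Nn z t")
        case True
        then show ?thesis using Suc.IH le_SucI by blast
      next
        case False
        obtain j where j: "Nn z t = real j" using hits_natural unfolding Nn_def by blast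
        have "Nn z (Suc t) = real k" using False Suc.prems j by (cases "H t z") (auto simp: Nn_def)
        then show ?thesis by blast
      qed
    qed (auto simp: Nn_def)
    have "(\<lambda>t. T t z / Nn z t) \<longlonglongrightarrow> 0"
    proof (rule LIMSEQ_I)
      fix e :: real assume e: "0 < e"
      have "\<forall>\<^sub>F j in sequentially. R j \<omega> < ennreal ((e/2)\<^sup>2)"
        using order_tendstoD(2)[OF R0] e by simp
      then obtain j0 where j0: "\<And>j. j \<ge> j0 \<Longrightarrow> R j \<omega> < ennreal ((e/2)\<^sup>2)"
        by (auto simp: eventually_sequentially)
      \<comment> \<open>For \<open>j \<ge> 4 / e\<close> the at most \<open>2 * j\<close> selections after the square \<open>j\<^sup>2\<close> contribute at most half
        of \<open>e * j\<^sup>2\<close>.\<close>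
      define J where "J = max (max 1 j0) (nat \<lceil>4 / e\<rceil>)"
      obtain t0 where t0: "\<And>t. t \<ge> t0 \<Longrightarrow> Nn z t \<ge> (real J)\<^sup>2"
        using inf unfolding filterlim_at_top eventually_sequentially Nn_def z_def by blast
      have "norm (T t z / Nn z t - 0) < e" if t: "t \<ge> t0" for t
      proof -
        obtain n where n: "Nn z t = real n" using hits_natural unfolding Nn_def by blast
        define j where "j = floor_sqrt n"
        have jn: "j\<^sup>2 \<le> n" "n < (Suc j)\<^sup>2" unfolding j_def
          by (auto simp: Suc_floor_sqrt_power2_gt)
        have "real (J\<^sup>2) \<le> real n" using t0[OF t] n by simp
        then have "J\<^sup>2 \<le> n" by (simp only: of_nat_le_iff)
        then have "J\<^sup>2 < (Suc j)\<^sup>2" using jn(2) by simp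
        then have Jj: "J \<le> j" using power2_less_imp_less[of J "Suc j"] by simp
        then have j: "j \<ge> 1" "j \<ge> j0" "4 / e \<le> real j"
          unfolding J_def by linarith+
        have "real (j\<^sup>2) \<le> Nn z t" unfolding n using jn(1) of_nat_le_iff by blast
        from reach[OF this] obtain t' where t': "t' \<le> t" "Nn z t' = real (j\<^sup>2)" by blast
        have "liminf (\<lambda>n. ennreal ((S (real (j\<^sup>2)) n z)\<^sup>2)) = ennreal ((T t' z)\<^sup>2)"
        proof (rule lim_imp_Liminf)
          have "S (real (j\<^sup>2)) n z = T t' z" if "t' \<le> n" for n
            using stopped[OF that] t'(2) by (simp only:)
          then have "\<forall>\<^sub>F n in sequentially. ennreal ((S (real (j\<^sup>2)) n z)\<^sup>2) = ennreal ((T t' z)\<^sup>2)"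
            unfolding eventually_sequentially by metis
          then show "(\<lambda>n. ennreal ((S (real (j\<^sup>2)) n z)\<^sup>2)) \<longlonglongrightarrow> ennreal ((T t' z)\<^sup>2)"
            by (rule tendsto_eventually)
        qed simp
        then have "R j \<omega> = ennreal ((T t' z)\<^sup>2 / real j ^ 4)"
          using j(1) by (simp add: R_def z_def divide_ennreal)
        with j0[OF j(2)] have "(T t' z)\<^sup>2 / real j ^ 4 < (e/2)\<^sup>2" by (simp add: ennreal_less_iff)
        then have "(T t' z / (real j)\<^sup>2)\<^sup>2 < (e/2)\<^sup>2"
          by (simp add: power_divide flip: power_mult)
        then have "\<bar>T t' z / (real j)\<^sup>2\<bar>\<^sup>2 < (e/2)\<^sup>2" by (simp only: power2_abs)
        then have "\<bar>T t' z / (real j)\<^sup>2\<bar> < e/2" by (rule power2_less_imp_less) (use e in simp)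
        then have T': "\<bar>T t' z\<bar> < e/2 * (real j)\<^sup>2" using j(1) by (simp add: field_simps)
        have "n \<le> j\<^sup>2 + 2 * j" using jn(2) by (simp add: power2_eq_square)
        then have "real n \<le> real (j\<^sup>2 + 2 * j)" by (simp only: of_nat_le_iff)
        then have "Nn z t - Nn z t' \<le> 2 * real j" using n t'(2) by simp
        also have "\<dots> \<le> e/2 * (real j)\<^sup>2"
        proof -
          have "4 \<le> e * real j" using j(3) e by (simp add: field_simps)
          then have "4 * real j \<le> e * real j * real j" by (intro mult_right_mono) auto
          then show ?thesis by (simp add: power2_eq_square)
        qed
        finally have "\<bar>T t z\<bar> < e * (real j)\<^sup>2"
          using T' T_N[OF t'(1)] by linarith
        also have "\<dots> \<le> e * Nn z t" using \<open>real (j\<^sup>2) \<le> Nn z t\<close> e by (intro mult_left_mono) auto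
        finally have "\<bar>T t z\<bar> < e * Nn z t" .
        moreover have "0 < Nn z t"
          using \<open>real (j\<^sup>2) \<le> Nn z t\<close> j(1) by (smt (verit) of_nat_0_less_iff zero_less_power less_le_trans zero_less_one)
        ultimately show ?thesis by (simp add: abs_divide pos_divide_less_eq)
      qed
      then show "\<exists>no. \<forall>t\<ge>no. norm (T t z / Nn z t - 0) < e" by blast
    qed
    moreover have "T t z = hits (\<lambda>i. H i z \<and> z (Suc i) \<in> A) t - measure \<pi> A * Nn z t" for t
      unfolding T_def Nn_def by (induction t) (auto simp: f_def indicator_def algebra_simps)
    moreover have "\<forall>\<^sub>F t in sequentially. 0 < Nn z t"
      using inf unfolding Nn_def z_def filterlim_at_top_dense by blast
    ultimately have "(\<lambda>t. hits (\<lambda>i. H i z \<and> z (Suc i) \<in> A) t / Nn z t - measure \<pi> A) \<longlonglongrightarrow> 0"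
      by (elim Lim_transform_eventually) (auto elim!: eventually_mono simp: field_simps)
    then show "(\<lambda>t. hits (\<lambda>i. H i (\<lambda>k. Z k \<omega>) \<and> Z (Suc i) \<omega> \<in> A) t / hits (\<lambda>i. H i (\<lambda>k. Z k \<omega>)) t)
       \<longlonglongrightarrow> measure \<pi> A"
      unfolding z_def Nn_def by (rule LIM_zero_cancel)
  qed
qed

end

section \<open>Pairs drawn from an atomless distribution\<close>

definition pairs_with :: "real \<Rightarrow> real set \<Rightarrow> (real \<times> real) set" where
  "pairs_with c U = {z. c \<le> (fst z + snd z) / 2 \<and> min (fst z) (snd z) \<in> U}"

text \<open>
  For independent \<open>X\<close> and \<open>Y\<close> with law \<open>\<mu>\<close>, this is the probability that the mean is at least \<open>c\<close> and the
  minimum lies in \<open>U\<close>.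
\<close>
definition pass_prob :: "real measure \<Rightarrow> real \<Rightarrow> real set \<Rightarrow> real" where
  "pass_prob \<mu> c U = measure (\<mu> \<Otimes>\<^sub>M \<mu>) (pairs_with c U)"

lemma pairs_with_sets [measurable]:
  assumes [measurable]: "U \<in> sets borel"
  shows "pairs_with c U \<in> sets (borel \<Otimes>\<^sub>M borel)"
proof -
  have "Measurable.pred (borel \<Otimes>\<^sub>M borel) (\<lambda>z. c \<le> (fst z + snd z) / 2 \<and> min (fst z) (snd z) \<in> U)"
    by measurable
  then show ?thesis unfolding pairs_with_def pred_def by (simp add: space_pair_measure)
qed

text \<open>
  Each point outside the support has a null neighbourhood with rational end points, and there are
  only countably many of these.
\<close>
lemma complement_measure_support:
  assumes "sets \<mu> = sets borel"
  shows "- measure_support \<mu> \<in> null_sets \<mu>"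
proof -
  define I where "I = {(p, q) \<in> \<rat> \<times> \<rat>. {p<..<q} \<in> null_sets \<mu>}"
  have "- measure_support \<mu> = (\<Union>(p, q)\<in>I. {p<..<q})"
  proof (intro set_eqI iffI)
    fix x assume "x \<in> - measure_support \<mu>"
    then obtain U where U: "open U" "x \<in> U" "emeasure \<mu> U = 0"
      by (auto simp: measure_support_def not_less)
    then obtain e where e: "0 < e" "ball x e \<subseteq> U" using open_contains_ball by blast
    obtain p where p: "p \<in> \<rat>" "x - e < p" "p < x" using Rats_dense_in_real[of "x - e" x] e by auto
    obtain q where q: "q \<in> \<rat>" "x < q" "q < x + e" using Rats_dense_in_real[of x "x + e"] e by auto
    have "{p<..<q} \<subseteq> U" using e p q by (auto simp: subset_eq dist_real_def abs_if)
    moreover have "U \<in> null_sets \<mu>" using U assms by (auto simp: null_sets_def)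
    ultimately have "{p<..<q} \<in> null_sets \<mu>"
      using assms null_sets_subset by (metis borel_open open_greaterThanLessThan)
    then show "x \<in> (\<Union>(p, q)\<in>I. {p<..<q})" using p q by (auto simp: I_def)
  next
    fix x assume "x \<in> (\<Union>(p, q)\<in>I. {p<..<q})"
    then obtain p q where "p < x" "x < q" "{p<..<q} \<in> null_sets \<mu>" by (auto simp: I_def)
    then show "x \<in> - measure_support \<mu>"
      by (auto simp: measure_support_def null_sets_def intro!: exI[of _ "{p<..<q}"])
  qed
  moreover have "countable I" unfolding I_def
    by (rule countable_subset[of _ "\<rat> \<times> \<rat>"]) (auto simp: countable_rat)
  ultimately show ?thesis by (auto simp: I_def intro!: null_sets_UN')
qed

lemma closed_measure_support: "closed (measure_support \<mu>)"
proof -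
  have "open (- measure_support \<mu>)" unfolding open_contains_ball
  proof (intro ballI)
    fix x assume "x \<in> - measure_support \<mu>"
    then obtain U where U: "open U" "x \<in> U" "emeasure \<mu> U = 0"
      by (auto simp: measure_support_def not_less)
    then have "U \<subseteq> - measure_support \<mu>" by (auto simp: measure_support_def not_less)
    then show "\<exists>e>0. ball x e \<subseteq> - measure_support \<mu>"
      using U open_contains_ball by (metis order_trans)
  qed
  then show ?thesis by (simp add: closed_def)
qed

locale atomless_distribution = real_distribution \<mu> for \<mu> :: "real measure" +
  assumes atomless: "emeasure \<mu> {x} = 0"
begin

sublocale pair: pair_prob_space \<mu> \<mu> ..

lemma sets_pair [simp]: "sets (\<mu> \<Otimes>\<^sub>M \<mu>) = sets (borel \<Otimes>\<^sub>M borel)"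
  by (intro sets_pair_measure_cong) simp_all

lemma space_pair [simp]: "space (\<mu> \<Otimes>\<^sub>M \<mu>) = UNIV"
  by (simp add: space_pair_measure)

lemma measure_singleton [simp]: "measure \<mu> {x} = 0"
  using atomless by (simp add: measure_def)

lemma cdf_eq_tail: "cdf \<mu> u = 1 - measure \<mu> {u<..}"
proof -
  have "measure \<mu> (space \<mu> - {u<..}) = 1 - measure \<mu> {u<..}" by (rule prob_compl) simp
  moreover have "space \<mu> - {u<..} = {..u}" by auto
  ultimately show ?thesis by (simp add: cdf_def)
qed

lemma isCont_tail: "isCont (\<lambda>u. measure \<mu> {u<..}) u"
proof -
  have "isCont (\<lambda>u. 1 - cdf \<mu> u) u" by (intro continuous_intros) (simp add: isCont_cdf)
  then show ?thesis by (simp add: cdf_eq_tail)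
qed

lemma support_le_mu_max: "x \<in> measure_support \<mu> \<Longrightarrow> ereal x \<le> mu_max \<mu>"
  unfolding mu_max_def by (rule SUP_upper)

text \<open>
  No sampled value equals \<open>mu_max\<close>, since this is a single point. The value \<open>real_of_ereal\<close> of
  an infinite \<open>mu_max\<close> is a harmless default: its complement has full measure all the same.
\<close>
lemma AE_support: "AE x in \<mu>. x \<in> measure_support \<mu> \<and> ereal x < mu_max \<mu>"
proof -
  have "AE x in \<mu>. x \<in> measure_support \<mu>"
    using complement_measure_support[of \<mu>] by (auto intro!: AE_I'[of "- measure_support \<mu>"])
  moreover have "AE x in \<mu>. x \<noteq> real_of_ereal (mu_max \<mu>)"
    by (rule AE_I'[of "{real_of_ereal (mu_max \<mu>)}"]) (auto simp: null_sets_def atomless)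
  ultimately show ?thesis
  proof eventually_elim
    case (elim x)
    then show ?case using support_le_mu_max[of x] by (cases "mu_max \<mu>") auto
  qed
qed

lemma open_interval_positive:
  assumes "z \<in> measure_support \<mu>" "a < z" "z < b"
  shows "0 < measure \<mu> {a<..<b}"
proof -
  have "0 < emeasure \<mu> {a<..<b}" using assms by (auto simp: measure_support_def)
  then show ?thesis by (simp add: emeasure_eq_measure)
qed

lemma tail_positive:
  assumes "ereal u < mu_max \<mu>"
  shows "0 < measure \<mu> {u<..}"
proof -
  obtain z where z: "z \<in> measure_support \<mu>" "u < z"
    using assms unfolding mu_max_def less_SUP_iff by auto
  have "0 < measure \<mu> {u<..<z + 1}" using z by (intro open_interval_positive) auto
  also have "\<dots> \<le> measure \<mu> {u<..}" by (intro finite_measure_mono) auto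
  finally show ?thesis .
qed

lemma pass_prob_UNIV: "pass_prob \<mu> c UNIV = measure (\<mu> \<star> \<mu>) {2 * c..}"
proof -
  have "(\<lambda>(x, y). x + y) \<in> measurable (\<mu> \<Otimes>\<^sub>M \<mu>) borel"
    unfolding measurable_cong_sets[OF sets_pair refl] by measurable
  then have "measure (\<mu> \<star> \<mu>) {2 * c..} = measure (\<mu> \<Otimes>\<^sub>M \<mu>) ((\<lambda>(x, y). x + y) -` {2 * c..} \<inter> space (\<mu> \<Otimes>\<^sub>M \<mu>))"
    unfolding convolution_def by (subst measure_distr) auto
  also have "(\<lambda>(x, y). x + y) -` {2 * c..} \<inter> space (\<mu> \<Otimes>\<^sub>M \<mu>) = pairs_with c UNIV"
    by (auto simp: pairs_with_def)
  finally show ?thesis by (simp add: pass_prob_def)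
qed

lemma pass_prob_mono:
  assumes "c' \<le> c" "U \<subseteq> V" "U \<in> sets borel" "V \<in> sets borel"
  shows "pass_prob \<mu> c U \<le> pass_prob \<mu> c' V"
proof -
  have "pairs_with c U \<subseteq> pairs_with c' V" using assms by (auto simp: pairs_with_def)
  then show ?thesis unfolding pass_prob_def
    using assms pairs_with_sets by (intro pair.finite_measure_mono) simp_all
qed

text \<open>
  This transfers the continuity of \<open>c \<mapsto> pass_prob \<mu> c UNIV\<close> to every \<open>U\<close> at once.
\<close>
lemma pass_prob_diff_le:
  assumes "c \<le> c'" and [measurable]: "U \<in> sets borel"
  shows "pass_prob \<mu> c U - pass_prob \<mu> c' U \<le> pass_prob \<mu> c UNIV - pass_prob \<mu> c' UNIV"
proof -
  have d: "pass_prob \<mu> c V - pass_prob \<mu> c' V = measure (\<mu> \<Otimes>\<^sub>M \<mu>) (pairs_with c V - pairs_with c' V)"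
    if "V \<in> sets borel" for V
  proof -
    have "pairs_with c' V \<subseteq> pairs_with c V" using assms(1) by (auto simp: pairs_with_def)
    then show ?thesis unfolding pass_prob_def
      using that pairs_with_sets by (intro pair.finite_measure_Diff[symmetric]) simp_all
  qed
  have "pairs_with c U - pairs_with c' U \<subseteq> pairs_with c UNIV - pairs_with c' UNIV"
    by (auto simp: pairs_with_def)
  then show ?thesis
    using d[of U] d[of UNIV] assms(2) pairs_with_sets[of UNIV]
    by (simp add: pair.finite_measure_mono sets.Diff)
qed

text \<open>
  The sum of two independent atomless variables is atomless.
\<close>
lemma isCont_pass_prob: "isCont (\<lambda>c. pass_prob \<mu> c UNIV) c"
proof -
  interpret conv: real_distribution "\<mu> \<star> \<mu>"
    unfolding convolution_def
    by (intro real_distribution_distr pair.real_distribution_distr) (simp add: measurable_cong_sets[OF sets_pair refl])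
  have at: "measure (\<mu> \<star> \<mu>) {s} = 0" for s
  proof -
    have "emeasure (\<mu> \<star> \<mu>) {s} = (\<integral>\<^sup>+x. emeasure \<mu> {a. a + x \<in> {s}} \<partial>\<mu>)"
      by (rule convolution_emeasure) (auto simp: finite_measure_axioms)
    also have "\<dots> = (\<integral>\<^sup>+x. emeasure \<mu> {s - x} \<partial>\<mu>)"
      by (intro nn_integral_cong arg_cong2[where f=emeasure]) (auto simp: algebra_simps)
    finally show ?thesis by (simp add: atomless measure_def)
  qed
  have eq: "pass_prob \<mu> c UNIV = 1 - cdf (\<mu> \<star> \<mu>) (2 * c)" for c
  proof -
    have "measure (\<mu> \<star> \<mu>) (space (\<mu> \<star> \<mu>) - {..<2 * c}) = 1 - measure (\<mu> \<star> \<mu>) {..<2 * c}"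
      by (rule conv.prob_compl) simp
    moreover have "space (\<mu> \<star> \<mu>) - {..<2 * c} = {2 * c..}" by auto
    moreover have "measure (\<mu> \<star> \<mu>) {..2 * c} = measure (\<mu> \<star> \<mu>) {..<2 * c} + measure (\<mu> \<star> \<mu>) {2 * c}"
      by (subst conv.finite_measure_Union[symmetric]) (auto intro!: arg_cong[where f="measure _"])
    ultimately show ?thesis by (simp add: pass_prob_UNIV cdf_def at)
  qed
  have "isCont (\<lambda>c. cdf (\<mu> \<star> \<mu>) (2 * c)) c"
    by (rule isCont_o2[where g="cdf (\<mu> \<star> \<mu>)"]) (auto intro!: continuous_intros simp: conv.isCont_cdf at)
  then show ?thesis unfolding eq by (intro continuous_intros)
qed

lemma pass_prob_tail:
  assumes "c \<le> u"
  shows "pass_prob \<mu> c {u<..} = (measure \<mu> {u<..})\<^sup>2"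
proof -
  have "pairs_with c {u<..} = {u<..} \<times> {u<..}" using assms by (auto simp: pairs_with_def)
  then show ?thesis unfolding pass_prob_def
    by (simp add: measure_def emeasure_pair_measure_Times enn2real_mult power2_eq_square)
qed

lemma pass_prob_split: "pass_prob \<mu> c UNIV = pass_prob \<mu> c {..u} + pass_prob \<mu> c {u<..}"
proof -
  have "pairs_with c UNIV = pairs_with c {..u} \<union> pairs_with c {u<..}"
    by (auto simp: pairs_with_def)
  moreover have "pairs_with c {..u} \<inter> pairs_with c {u<..} = {}" by (auto simp: pairs_with_def)
  ultimately show ?thesis unfolding pass_prob_def
    using pairs_with_sets by (simp add: pair.finite_measure_Union)
qed

lemma pass_prob_positive:
  assumes "ereal c < mu_max \<mu>"
  shows "0 < pass_prob \<mu> c UNIV"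
proof -
  have "0 < (measure \<mu> {c<..})\<^sup>2" using tail_positive[OF assms] by simp
  also have "\<dots> \<le> pass_prob \<mu> c UNIV"
    unfolding pass_prob_tail[OF order_refl, symmetric] by (rule pass_prob_mono) auto
  finally show ?thesis .
qed

text \<open>
  A value in \<open>(c, z')\<close> together with a partner above \<open>2 * z' - c\<close> has its mean above \<open>z'\<close> and
  contributes the smaller value. Both events have positive probability.
\<close>
lemma pass_prob_near_support:
  assumes z: "z \<in> measure_support \<mu>" "c < z" "z < z'" and "ereal (2 * z' - c) < mu_max \<mu>"
  shows "0 < pass_prob \<mu> z' {c<..z'}"
proof -
  have "0 < measure \<mu> {c<..<z'} * measure \<mu> {2 * z' - c<..}"
    using open_interval_positive[OF z] tail_positive[OF assms(4)] by simp
  also have "\<dots> = measure (\<mu> \<Otimes>\<^sub>M \<mu>) ({c<..<z'} \<times> {2 * z' - c<..})"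
    by (simp add: measure_def emeasure_pair_measure_Times enn2real_mult)
  also have "\<dots> \<le> pass_prob \<mu> z' {c<..z'}"
  proof -
    have "{c<..<z'} \<times> {2 * z' - c<..} \<subseteq> pairs_with z' {c<..z'}"
      using z by (auto simp: pairs_with_def min_def)
    then show ?thesis unfolding pass_prob_def
      using pairs_with_sets by (intro pair.finite_measure_mono) simp_all
  qed
  finally show ?thesis .
qed

text \<open>
  By symmetry and the absence of ties, half of the pairs with mean at least \<open>m\<close> have their first
  component as minimum, and for first component \<open>x\<close> the admissible partners form
  \<open>{x..} \<inter> {2 * m - x..}\<close>. This explains the factor 2.
\<close>
lemma pass_law:
  assumes m: "ereal m < mu_max \<mu>"
  defines "L \<equiv> density \<mu> (\<lambda>x. ennreal (2 / pass_prob \<mu> m UNIV * measure \<mu> ({x..} \<inter> {2 * m - x..})))"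
  shows "real_distribution L" and "cdf L u = pass_prob \<mu> m {..u} / pass_prob \<mu> m UNIV"
    and "isCont (cdf L) u"
proof -
  let ?P = "pass_prob \<mu> m"
  have pos: "0 < ?P UNIV" by (rule pass_prob_positive[OF m])
  have mw [measurable]: "(\<lambda>x. measure \<mu> ({x..} \<inter> {2 * m - x..})) \<in> borel_measurable \<mu>"
  proof -
    have "Measurable.pred (borel \<Otimes>\<^sub>M borel) (\<lambda>z::real\<times>real. fst z \<le> snd z \<and> 2 * m - fst z \<le> snd z)"
      by measurable
    then have "{z. fst z \<le> snd z \<and> 2 * m - fst z \<le> snd z} \<in> sets (\<mu> \<Otimes>\<^sub>M \<mu>)"
      unfolding pred_def by (simp add: space_pair_measure)
    from measurable_emeasure_Pair[OF this] show ?thesis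
      unfolding measure_def by (simp add: vimage_def Int_def)
  qed
  have half: "emeasure L U = ennreal (?P U / ?P UNIV)" if U[measurable]: "U \<in> sets borel" for U
  proof -
    \<comment> \<open>\<open>A\<close> and \<open>B\<close> collect the pairs whose first or second component, respectively, is the minimum;
      they overlap on the diagonal only.\<close>
    define A where "A = {z :: real \<times> real. fst z \<in> U \<and> fst z \<le> snd z \<and> 2 * m - fst z \<le> snd z}"
    define B where "B = {z :: real \<times> real. snd z \<in> U \<and> snd z \<le> fst z \<and> 2 * m - fst z \<le> snd z}"
    have A: "A \<in> sets (borel \<Otimes>\<^sub>M borel)"
    proof -
      have "Measurable.pred (borel \<Otimes>\<^sub>M borel) (\<lambda>z::real\<times>real. fst z \<in> U \<and> fst z \<le> snd z \<and> 2 * m - fst z \<le> snd z)"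
        by measurable
      then show ?thesis unfolding A_def pred_def by (simp add: space_pair_measure)
    qed
    have B: "B \<in> sets (borel \<Otimes>\<^sub>M borel)"
    proof -
      have "Measurable.pred (borel \<Otimes>\<^sub>M borel) (\<lambda>z::real\<times>real. snd z \<in> U \<and> snd z \<le> fst z \<and> 2 * m - fst z \<le> snd z)"
        by measurable
      then show ?thesis unfolding B_def pred_def by (simp add: space_pair_measure)
    qed
    have "emeasure (\<mu> \<Otimes>\<^sub>M \<mu>) B = emeasure (distr (\<mu> \<Otimes>\<^sub>M \<mu>) (\<mu> \<Otimes>\<^sub>M \<mu>) (\<lambda>(x, y). (y, x))) B"
      by (simp flip: pair.distr_pair_swap)
    also have "\<dots> = emeasure (\<mu> \<Otimes>\<^sub>M \<mu>) ((\<lambda>(x, y). (y, x)) -` B \<inter> space (\<mu> \<Otimes>\<^sub>M \<mu>))"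
      using B by (intro emeasure_distr) (auto simp: measurable_split_conv intro!: measurable_Pair)
    also have "(\<lambda>(x, y). (y, x)) -` B \<inter> space (\<mu> \<Otimes>\<^sub>M \<mu>) = A"
      by (auto simp: A_def B_def)
    finally have AB: "measure (\<mu> \<Otimes>\<^sub>M \<mu>) B = measure (\<mu> \<Otimes>\<^sub>M \<mu>) A" by (simp add: measure_def)
    have int: "A \<inter> B \<in> null_sets (\<mu> \<Otimes>\<^sub>M \<mu>)"
    proof -
      have "emeasure (\<mu> \<Otimes>\<^sub>M \<mu>) (A \<inter> B) = (\<integral>\<^sup>+x. emeasure \<mu> (Pair x -` (A \<inter> B)) \<partial>\<mu>)"
        using A B by (intro emeasure_pair_measure_alt) simp
      also have "\<dots> \<le> (\<integral>\<^sup>+x. emeasure \<mu> {x} \<partial>\<mu>)"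
        by (intro nn_integral_mono emeasure_mono) (auto simp: A_def B_def)
      finally show ?thesis using A B by (auto simp: null_sets_def atomless)
    qed
    have "pairs_with m U = A \<union> B"
      by (auto simp: pairs_with_def A_def B_def min_def)
    moreover have "measure (\<mu> \<Otimes>\<^sub>M \<mu>) (A \<union> B) =
        measure (\<mu> \<Otimes>\<^sub>M \<mu>) A + measure (\<mu> \<Otimes>\<^sub>M \<mu>) B - measure (\<mu> \<Otimes>\<^sub>M \<mu>) (A \<inter> B)"
      by (rule measure_Un3) (simp_all add: pair.fmeasurable_eq_sets A B)
    ultimately have PU: "?P U = 2 * measure (\<mu> \<Otimes>\<^sub>M \<mu>) A"
      using AB measure_eq_0_null_sets[OF int] by (simp add: pass_prob_def)
    have "emeasure L U = (\<integral>\<^sup>+x. ennreal (2 / ?P UNIV * measure \<mu> ({x..} \<inter> {2 * m - x..})) * indicator U x \<partial>\<mu>)"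
      unfolding L_def using pos by (intro emeasure_density) (auto intro!: measurable_ennreal borel_measurable_times)
    also have "\<dots> = (\<integral>\<^sup>+x. ennreal (2 / ?P UNIV) * emeasure \<mu> (Pair x -` A) \<partial>\<mu>)"
    proof (intro nn_integral_cong)
      fix x
      have "Pair x -` A = (if x \<in> U then {x..} \<inter> {2 * m - x..} else {})" by (auto simp: A_def)
      then show "ennreal (2 / ?P UNIV * measure \<mu> ({x..} \<inter> {2 * m - x..})) * indicator U x
          = ennreal (2 / ?P UNIV) * emeasure \<mu> (Pair x -` A)"
        using pos by (simp add: emeasure_eq_measure ennreal_mult[symmetric])
    qed
    also have "\<dots> = ennreal (2 / ?P UNIV) * emeasure (\<mu> \<Otimes>\<^sub>M \<mu>) A"
      using A by (subst nn_integral_cmult) (auto simp: emeasure_pair_measure_alt intro!: measurable_emeasure_Pair)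
    also have "\<dots> = ennreal (?P U / ?P UNIV)"
      using pos by (simp add: PU pair.emeasure_eq_measure ennreal_mult[symmetric])
    finally show ?thesis .
  qed
  show L: "real_distribution L"
  proof (intro real_distribution.intro real_distribution_axioms.intro prob_spaceI)
    have "space L = UNIV" by (simp add: L_def)
    then show "emeasure L (space L) = 1" using half[of UNIV] pos by simp
  qed (simp add: L_def)
  interpret L: real_distribution L by (rule L)
  show "cdf L u = ?P {..u} / ?P UNIV"
    using half[of "{..u}"] pos by (simp add: cdf_def measure_def pass_prob_def)
  have "emeasure L {u} = 0"
    unfolding L_def
    by (subst emeasure_density) (auto intro!: nn_integral_null_set simp: null_sets_def atomless)
  then show "isCont (cdf L) u" by (simp add: L.isCont_cdf measure_def)
qed

end

section \<open>Rare events\<close>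

lemma hits_bounded_imp_eventually_not:
  assumes "\<And>t. hits P t \<le> B"
  shows "\<forall>\<^sub>F i in sequentially. \<not> P i"
proof -
  have "Bseq (hits P)" using assms by (intro BseqI'[of _ B]) simp
  then have "convergent (hits P)" using mono_hits[of P] by (intro Bseq_mono_convergent) (auto dest: monoD)
  then obtain l where l: "hits P \<longlonglongrightarrow> l" by (auto simp: convergent_def)
  from tendsto_diff[OF LIMSEQ_Suc[OF l] l]
  have "(\<lambda>t. hits P (Suc t) - hits P t) \<longlonglongrightarrow> 0" by simp
  then have "\<forall>\<^sub>F t in sequentially. hits P (Suc t) - hits P t < 1"
    by (rule order_tendstoD) simp
  then show ?thesis by eventually_elim (auto split: if_splits)
qed

lemma hits_eventually_le:
  assumes "\<forall>\<^sub>F i in sequentially. P i \<longrightarrow> Q i"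
  shows "\<exists>C\<ge>0. \<forall>t. hits P t \<le> hits Q t + C"
proof -
  obtain t0 where t0: "\<And>i. i \<ge> t0 \<Longrightarrow> P i \<Longrightarrow> Q i"
    using assms by (auto simp: eventually_sequentially)
  have "hits P t \<le> hits Q t + real t0" for t
  proof -
    have "hits P t \<le> hits Q t + hits (\<lambda>i. i < t0) t"
      by (rule hits_le_add) (use t0 not_less in blast)
    moreover have "hits (\<lambda>i. i < t0) t \<le> real (min t t0)" by (induction t) auto
    ultimately show ?thesis by linarith
  qed
  then show ?thesis by (intro exI[of _ "real t0"]) simp
qed

text \<open>
  The scale \<open>g\<close> is either time or the number of admissions. The two can differ in order.
\<close>
definition rare :: "(nat \<Rightarrow> bool) \<Rightarrow> (nat \<Rightarrow> real) \<Rightarrow> bool" where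
  "rare P g \<longleftrightarrow> (\<lambda>t. hits P t / g t) \<longlonglongrightarrow> 0"

lemma rare_by_bound:
  assumes g: "filterlim g at_top sequentially"
    and f: "(\<lambda>t. f t / g t) \<longlonglongrightarrow> 0" and le: "\<forall>\<^sub>F t in sequentially. hits P t \<le> f t + C"
  shows "rare P g"
proof -
  have "(\<lambda>t. f t / g t + C / g t) \<longlonglongrightarrow> 0 + 0"
    by (intro tendsto_add f tendsto_divide_0[OF tendsto_const] filterlim_at_top_imp_at_infinity g)
  moreover have gpos: "\<forall>\<^sub>F t in sequentially. 0 < g t"
    using g by (simp add: filterlim_at_top_dense)
  ultimately show ?thesis unfolding rare_def
  proof (intro tendsto_sandwich[of "\<lambda>_. 0" "\<lambda>t. hits P t / g t" _ "\<lambda>t. f t / g t + C / g t"])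
    show "\<forall>\<^sub>F t in sequentially. 0 \<le> hits P t / g t" using gpos by eventually_elim simp
    show "\<forall>\<^sub>F t in sequentially. hits P t / g t \<le> f t / g t + C / g t"
      using gpos le by eventually_elim (simp add: divide_right_mono flip: add_divide_distrib)
  qed auto
qed

lemma rare_mono:
  assumes "filterlim g at_top sequentially" "rare Q g" "\<forall>\<^sub>F i in sequentially. P i \<longrightarrow> Q i"
  shows "rare P g"
proof -
  obtain C where C: "\<And>t. hits P t \<le> hits Q t + C" using hits_eventually_le[OF assms(3)] by blast
  show ?thesis
    by (rule rare_by_bound[OF assms(1) assms(2)[unfolded rare_def], of _ C]) (simp add: C)
qed

lemma rare_eventually_not:
  assumes "filterlim g at_top sequentially" "\<forall>\<^sub>F i in sequentially. \<not> P i"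
  shows "rare P g"
proof (rule rare_mono[OF assms(1)])
  show "rare (\<lambda>_. False) g" by (simp add: rare_def hits_def)
qed (use assms(2) in simp)

lemma rare_bounded:
  assumes "filterlim g at_top sequentially" "\<And>t. hits P t \<le> B"
  shows "rare P g"
  using rare_eventually_not[OF assms(1) hits_bounded_imp_eventually_not[OF assms(2)]] .

text \<open>
  If each occurrence of \<open>H\<close> pushes \<open>\<bar>W\<bar>\<close> up by \<open>\<eta> > 0\<close> on average, then a negligible \<open>W\<close> leaves room for
  few occurrences only. The average \<open>X\<close> needs to settle only when \<open>H\<close> occurs infinitely often, because
  finitely many occurrences are rare anyway.
\<close>
lemma rare_of_drift:
  assumes g: "filterlim g at_top sequentially"
    and W: "(\<lambda>t. W t / g t) \<longlonglongrightarrow> 0"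
    and X: "filterlim (hits H) at_top sequentially \<Longrightarrow> X \<longlonglongrightarrow> \<eta>" and \<eta>: "0 < \<eta>"
    and le: "\<And>t. 0 < hits H t \<Longrightarrow> X t * hits H t \<le> \<bar>W t\<bar> + C"
  shows "rare H g"
proof -
  consider B where "\<And>t. hits H t \<le> B" | "filterlim (hits H) at_top sequentially"
    using hits_bounded_or_at_top[of H] by blast
  then show ?thesis
  proof cases
    case 1
    then show ?thesis by (rule rare_bounded[OF g])
  next
    case 2
    have "\<forall>\<^sub>F t in sequentially. \<eta> / 2 < X t" using X[OF 2] \<eta> by (intro order_tendstoD) auto
    moreover have "\<forall>\<^sub>F t in sequentially. 0 < hits H t" using 2 by (simp add: filterlim_at_top_dense)
    ultimately have "\<forall>\<^sub>F t in sequentially. hits H t \<le> 2 / \<eta> * \<bar>W t\<bar> + 2 / \<eta> * C"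
    proof eventually_elim
      case (elim t)
      have "\<eta> / 2 * hits H t \<le> X t * hits H t" using elim by (intro mult_right_mono) auto
      with le[OF elim(2)] have "\<eta> / 2 * hits H t \<le> \<bar>W t\<bar> + C" by linarith
      then show ?case using \<eta> by (simp add: field_simps)
    qed
    moreover have "(\<lambda>t. 2 / \<eta> * \<bar>W t\<bar> / g t) \<longlonglongrightarrow> 0"
    proof -
      have "(\<lambda>t. 2 / \<eta> * \<bar>W t / g t\<bar>) \<longlonglongrightarrow> 2 / \<eta> * \<bar>0\<bar>" using W by (intro tendsto_intros)
      moreover have "\<forall>\<^sub>F t in sequentially. 2 / \<eta> * \<bar>W t / g t\<bar> = 2 / \<eta> * \<bar>W t\<bar> / g t"
      proof -
        have "\<forall>\<^sub>F t in sequentially. 0 < g t" using g by (simp add: filterlim_at_top_dense)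
        then show ?thesis by eventually_elim (simp add: abs_divide)
      qed
      ultimately show ?thesis by (simp add: Lim_transform_eventually)
    qed
    ultimately show ?thesis by (intro rare_by_bound[OF g])
  qed
qed

lemma rational_below:
  fixes f :: "real \<Rightarrow> real"
  assumes "isCont f m" "open S" "f m \<in> S" "l < m"
  obtains d where "d \<in> \<rat>" "l < d" "d < m" "f d \<in> S"
proof -
  have "(f \<longlongrightarrow> f m) (at_left m)" using assms(1) unfolding isCont_def by (rule tendsto_within_subset) simp
  then have "\<forall>\<^sub>F d in at_left m. f d \<in> S" using assms(2,3) by (rule topological_tendstoD)
  then obtain b where b: "b < m" "\<And>d. b < d \<Longrightarrow> d < m \<Longrightarrow> f d \<in> S"
    using assms(4) by (auto simp: eventually_at_left[of l m])
  obtain d where "d \<in> \<rat>" "max l b < d" "d < m" using Rats_dense_in_real[of "max l b" m] b assms(4) by auto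
  then show thesis using that b by auto
qed

lemma rational_above:
  fixes f :: "real \<Rightarrow> real"
  assumes "isCont f m" "open S" "f m \<in> S" "m < u"
  obtains d where "d \<in> \<rat>" "m < d" "d < u" "f d \<in> S"
proof -
  have "(f \<longlongrightarrow> f m) (at_right m)" using assms(1) unfolding isCont_def by (rule tendsto_within_subset) simp
  then have "\<forall>\<^sub>F d in at_right m. f d \<in> S" using assms(2,3) by (rule topological_tendstoD)
  then obtain b where b: "m < b" "\<And>d. m < d \<Longrightarrow> d < b \<Longrightarrow> f d \<in> S"
    using assms(4) by (auto simp: eventually_at_right[of m u])
  obtain d where "d \<in> \<rat>" "m < d" "d < min u b" using Rats_dense_in_real[of m "min u b"] b assms(4) by auto
  then show thesis using that b by auto
qed

lemma (in real_distribution) continuity_point_between: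
  assumes "s < t"
  obtains q where "s < q" "q < t" "isCont (cdf M) q"
proof -
  obtain q where "q \<in> {s<..<t}" "q \<notin> {x. measure M {x} > 0}"
    using real_interval_avoid_countable_set[OF assms countable_atoms] by blast
  then show thesis using that by (auto simp: isCont_cdf zero_less_measure_iff)
qed

section \<open>The admission process along one sample path\<close>

text \<open>
  Step \<open>i\<close> processes the pair with index \<open>Suc i\<close> and acts on the multiset built from the first
  \<open>i\<close> pairs.
\<close>
definition mid :: "(nat \<Rightarrow> real) \<Rightarrow> (nat \<Rightarrow> real) \<Rightarrow> nat \<Rightarrow> real" where
  "mid x y i = (x (Suc i) + y (Suc i)) / 2"

definition low :: "(nat \<Rightarrow> real) \<Rightarrow> (nat \<Rightarrow> real) \<Rightarrow> nat \<Rightarrow> real" where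
  "low x y i = min (x (Suc i)) (y (Suc i))"

text \<open>
  The bar is an empirical \<open>r\<close>-quantile. Only comparisons of the bar with a level \<open>q\<close> matter, and these
  do not require choosing a value of the quantile for the empty multiset.
\<close>
definition bar_le :: "real \<Rightarrow> (nat \<Rightarrow> real) \<Rightarrow> (nat \<Rightarrow> real) \<Rightarrow> real \<Rightarrow> nat \<Rightarrow> bool" where
  "bar_le r x y q i \<longleftrightarrow>
     r * real (size (admitted r x y i)) \<le> real (size {#s \<in># admitted r x y i. s \<le> q#})"

definition accept :: "real \<Rightarrow> (nat \<Rightarrow> real) \<Rightarrow> (nat \<Rightarrow> real) \<Rightarrow> nat \<Rightarrow> bool" where
  "accept r x y i \<longleftrightarrow> bar_le r x y (mid x y i) i"

lemma admitted_Suc: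
  "admitted r x y (Suc t) =
     (if accept r x y t then add_mset (low x y t) (admitted r x y t) else admitted r x y t)"
  by (simp add: Let_def accept_def bar_le_def mid_def low_def)

lemma size_admitted_filter:
  "real (size {#s \<in># admitted r x y t. P s#}) = hits (\<lambda>i. accept r x y i \<and> P (low x y i)) t"
  by (induction t) (simp_all add: admitted_Suc del: admitted.simps(2))

lemma size_admitted: "real (size (admitted r x y t)) = hits (accept r x y) t"
  using size_admitted_filter[where P="\<lambda>_. True"] by simp

lemma bar_le_iff:
  "bar_le r x y q i \<longleftrightarrow>
     r * hits (accept r x y) i \<le> hits (\<lambda>j. accept r x y j \<and> low x y j \<le> q) i"
  by (simp add: bar_le_def size_admitted size_admitted_filter)

lemma bar_le_mono: "bar_le r x y q i \<Longrightarrow> q \<le> q' \<Longrightarrow> bar_le r x y q' i"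
  unfolding bar_le_iff by (erule order_trans) (auto intro: hits_mono)

lemma low_le_mid: "low x y i \<le> mid x y i"
  by (simp add: low_def mid_def)

text \<open>
  Countably many sets that suffice to determine the limit law and to detect mass near a point.
\<close>
definition test_sets :: "real set set" where
  "test_sets = insert UNIV (atMost ` \<rat> \<union> greaterThan ` \<rat> \<union> (\<lambda>(u, v). {u<..v}) ` (\<rat> \<times> \<rat>))"

lemma test_sets_borel: "U \<in> test_sets \<Longrightarrow> U \<in> sets borel"
  by (auto simp: test_sets_def)

lemma countable_test_sets: "countable test_sets"
  by (auto simp: test_sets_def countable_rat)

lemma test_setsI [simp]:
  "UNIV \<in> test_sets" "u \<in> \<rat> \<Longrightarrow> {..u} \<in> test_sets" "u \<in> \<rat> \<Longrightarrow> {u<..} \<in> test_sets"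
  "u \<in> \<rat> \<Longrightarrow> v \<in> \<rat> \<Longrightarrow> {u<..v} \<in> test_sets"
  by (auto simp: test_sets_def)

text \<open>
  What the deterministic argument needs to know about a sample path; almost every path satisfies
  it. The frequencies are required along three selections only: all steps, the steps with the bar at
  or below a rational level, and the steps with the bar above it.
\<close>
locale admission_path = atomless_distribution \<mu> for \<mu> :: "real measure" +
  fixes r :: real and x y :: "nat \<Rightarrow> real" and \<nu> :: "real measure"
  assumes r: "0 < r" "r < 1"
    and points: "x (Suc i) \<in> measure_support \<mu>" "y (Suc i) \<in> measure_support \<mu>"
      "ereal (x (Suc i)) < mu_max \<mu>" "ereal (y (Suc i)) < mu_max \<mu>"
    and frequencies:
      "\<lbrakk>q \<in> \<rat>; c \<in> \<rat>; U \<in> test_sets; H \<in> {\<lambda>i. True, bar_le r x y q, \<lambda>i. \<not> bar_le r x y q i};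
        filterlim (hits H) at_top sequentially\<rbrakk> \<Longrightarrow>
       (\<lambda>t. hits (\<lambda>i. H i \<and> (x (Suc i), y (Suc i)) \<in> pairs_with c U) t / hits H t)
         \<longlonglongrightarrow> pass_prob \<mu> c U"
    and limit: "real_distribution \<nu>"
    and convergence: "weak_conv_m (\<lambda>t. empirical_measure (admitted r x y (Suc t))) \<nu>"
begin

abbreviation "Mid \<equiv> mid x y"
abbreviation "Low \<equiv> low x y"
abbreviation "Bar_le \<equiv> bar_le r x y"
abbreviation "Acc \<equiv> accept r x y"
abbreviation "num \<equiv> hits Acc"
abbreviation "P c \<equiv> pass_prob \<mu> c UNIV"
abbreviation "F \<equiv> cdf \<nu>"

interpretation \<nu>: real_distribution \<nu> by (rule limit)

lemma selected_frequency:
  assumes "q \<in> \<rat>" "c \<in> \<rat>" "U \<in> test_sets" "H \<in> {Bar_le q, \<lambda>i. \<not> Bar_le q i}"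
    "filterlim (hits H) at_top sequentially"
  shows "(\<lambda>t. hits (\<lambda>i. H i \<and> c \<le> Mid i \<and> Low i \<in> U) t / hits H t) \<longlonglongrightarrow> pass_prob \<mu> c U"
  using frequencies[OF assms(1-3), of H] assms(4,5) by (auto simp: pairs_with_def mid_def low_def)

lemma hits_True [simp]: "hits (\<lambda>_. True) = real"
  by (simp add: hits_def fun_eq_iff)

lemma time_frequency:
  assumes "c \<in> \<rat>" "U \<in> test_sets"
  shows "(\<lambda>t. hits (\<lambda>i. c \<le> Mid i \<and> Low i \<in> U) t / real t) \<longlonglongrightarrow> pass_prob \<mu> c U"
  using frequencies[OF Rats_0 assms, of "\<lambda>_. True"] filterlim_real_sequentially
  by (auto simp: pairs_with_def mid_def low_def)

lemma Low_support: "Low i \<in> measure_support \<mu>" and Low_below: "ereal (Low i) < mu_max \<mu>"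
  using points[of i] by (auto simp: low_def min_def)

text \<open>
  If the admissions stopped, the bar would stay at or below some \<open>c < mu_max\<close>, and a positive proportion of
  the pairs would pass it.
\<close>
lemma num_at_top: "filterlim num at_top sequentially"
proof (rule ccontr)
  assume "\<not> filterlim num at_top sequentially"
  then obtain B where "\<And>t. num t \<le> B" using hits_bounded_or_at_top by blast
  then obtain t0 where t0: "\<And>i. i \<ge> t0 \<Longrightarrow> \<not> Acc i"
    using hits_bounded_imp_eventually_not[of Acc B] by (auto simp: eventually_sequentially)
  define h where "h = Max (insert (Low 0) (Low ` {..<t0}))"
  have "h \<in> insert (Low 0) (Low ` {..<t0})" unfolding h_def by (rule Max_in) auto
  then have "ereal h < mu_max \<mu>" using Low_below by auto
  then obtain c' where c': "ereal h < ereal c'" "ereal c' < mu_max \<mu>" using ereal_dense2 by blast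
  then obtain c where c: "c \<in> \<rat>" "h < c" "c < c'" using Rats_dense_in_real by auto
  have c_max: "ereal c < mu_max \<mu>" using c c' by (metis ereal_less_eq(3) less_imp_le order_le_less_trans)
  have bar: "Bar_le c i" for i
  proof -
    have "Low j \<le> c" if "Acc j" for j
    proof -
      have "j < t0" using t0 that not_less by blast
      then have "Low j \<le> h" unfolding h_def by (intro Max_ge) auto
      then show ?thesis using c by simp
    qed
    then have "hits (\<lambda>j. Acc j \<and> Low j \<le> c) i = num i"
      by (auto intro!: antisym hits_mono)
    then show ?thesis using r by (simp add: bar_le_iff mult_left_le_one_le)
  qed
  have "rare (\<lambda>i. c \<le> Mid i \<and> Low i \<in> UNIV) real"
  proof (rule rare_eventually_not[OF filterlim_real_sequentially])
    show "\<forall>\<^sub>F i in sequentially. \<not> (c \<le> Mid i \<and> Low i \<in> UNIV)"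
      unfolding eventually_sequentially
      using t0 bar bar_le_mono unfolding accept_def by (intro exI[of _ t0]) blast
  qed
  with time_frequency[OF c(1), of UNIV] have "P c = 0" unfolding rare_def by (auto dest: LIMSEQ_unique)
  then show False using pass_prob_positive[OF c_max] by simp
qed

lemma rare_time: "rare Q num \<Longrightarrow> rare Q real"
proof -
  assume Q: "rare Q num"
  show ?thesis unfolding rare_def
  proof (rule tendsto_sandwich[OF _ _ tendsto_const Q[unfolded rare_def]])
    have "\<forall>\<^sub>F t in sequentially. 0 < num t" using num_at_top by (simp add: filterlim_at_top_dense)
    then show "\<forall>\<^sub>F t in sequentially. hits Q t / real t \<le> hits Q t / num t"
      by eventually_elim (use hits_le in \<open>auto intro!: divide_left_mono mult_pos_pos dest: less_le_trans\<close>)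
  qed simp
qed

lemma empirical_cdf:
  assumes "isCont F q"
  shows "(\<lambda>t. hits (\<lambda>i. Acc i \<and> Low i \<le> q) t / num t) \<longlonglongrightarrow> F q"
proof -
  have "(\<lambda>t. cdf (empirical_measure (admitted r x y (Suc t))) q) \<longlonglongrightarrow> F q"
    using convergence assms by (simp add: weak_conv_m_def weak_conv_def)
  moreover have "cdf (empirical_measure (admitted r x y (Suc t))) q
      = hits (\<lambda>i. Acc i \<and> Low i \<le> q) (Suc t) / num (Suc t)" for t
  proof -
    have "cdf (empirical_measure (admitted r x y (Suc t))) q
        = real (size {#s \<in># admitted r x y (Suc t). s \<in> {..q}#}) / real (size (admitted r x y (Suc t)))"
      unfolding cdf_def by (rule measure_empirical_measure[OF admitted_nonempty]) auto
    then show ?thesis by (simp only: size_admitted size_admitted_filter atMost_iff)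
  qed
  ultimately have "(\<lambda>t. hits (\<lambda>i. Acc i \<and> Low i \<le> q) (Suc t) / num (Suc t)) \<longlonglongrightarrow> F q"
    by (simp only:)
  then show ?thesis by (rule LIMSEQ_imp_Suc[where f="\<lambda>t. hits (\<lambda>i. Acc i \<and> Low i \<le> q) t / num t"])
qed

section \<open>The bar is confined to the quantile interval of the limit\<close>

text \<open>
  The end points of the interval of \<open>r\<close>-quantiles of \<open>\<nu>\<close>.
\<close>
definition qlow :: real where "qlow = Inf {q. r \<le> F q}"
definition qhigh :: real where "qhigh = Inf {q. r < F q}"

lemma F_small: "\<exists>q0. \<forall>q\<le>q0. F q < r"
proof -
  have "\<forall>\<^sub>F q in at_bot. F q < r" by (rule order_tendstoD(2)[OF \<nu>.cdf_lim_at_bot r(1)])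
  then show ?thesis by (simp add: eventually_at_bot_linorder)
qed

lemma quantile_bounds: "bdd_below {q. r \<le> F q}" "bdd_below {q. r < F q}" "{q. r < F q} \<noteq> {}"
proof -
  obtain q0 where q0: "\<And>q. q \<le> q0 \<Longrightarrow> F q < r" using F_small by blast
  have q0_le: "q0 \<le> q" if "r \<le> F q" for q using q0[of q] that by force
  show "bdd_below {q. r \<le> F q}" using q0_le by (intro bdd_belowI[of _ q0]) simp
  show "bdd_below {q. r < F q}" using q0_le by (intro bdd_belowI[of _ q0]) (simp add: less_imp_le)
  have "\<forall>\<^sub>F q in at_top. r < F q" by (rule order_tendstoD(1)[OF \<nu>.cdf_lim_at_top_prob r(2)])
  then show "{q. r < F q} \<noteq> {}" by (auto simp: eventually_at_top_linorder)
qed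

lemma F_less_qlow: "q < qlow \<Longrightarrow> F q < r"
  using cInf_lower[OF _ quantile_bounds(1), of q] unfolding qlow_def by force

lemma F_less_qhigh: "q < qhigh \<Longrightarrow> F q \<le> r"
  using cInf_lower[OF _ quantile_bounds(2), of q] unfolding qhigh_def by force

lemma F_above_qhigh: "qhigh < q \<Longrightarrow> r < F q"
  using cInf_less_iff[OF quantile_bounds(3,2), of q] \<nu>.cdf_nondecreasing
  unfolding qhigh_def by (auto intro: less_le_trans)

lemma F_above_qlow: "qlow < q \<Longrightarrow> r \<le> F q"
proof -
  assume "qlow < q"
  moreover have "{q. r \<le> F q} \<noteq> {}" using quantile_bounds(3) by (auto intro: less_imp_le)
  ultimately obtain q' where "r \<le> F q'" "q' < q"
    using cInf_less_iff[OF _ quantile_bounds(1), of q] unfolding qlow_def by auto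
  then show ?thesis using \<nu>.cdf_nondecreasing[of q' q] by simp
qed

lemma qlow_le_qhigh: "qlow \<le> qhigh"
  unfolding qlow_def qhigh_def by (rule cInf_superset_mono[OF quantile_bounds(3,1)]) auto

lemma cdf_flat: assumes "qlow < q" "q < qhigh" shows "F q = r" "isCont F q"
proof -
  have eq: "F s = r" if "s \<in> {qlow<..<qhigh}" for s
    using F_above_qlow[of s] F_less_qhigh[of s] that by auto
  then show "F q = r" using assms by simp
  have "continuous_on {qlow<..<qhigh} F \<longleftrightarrow> continuous_on {qlow<..<qhigh} (\<lambda>_. r)"
    by (rule continuous_on_cong) (auto simp: eq)
  then show "isCont F q" using assms by (simp add: continuous_on_eq_continuous_at)
qed

lemma eventually_not_bar: "q < qlow \<Longrightarrow> \<forall>\<^sub>F i in sequentially. \<not> Bar_le q i"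
proof -
  assume "q < qlow"
  then obtain q' where q': "q < q'" "q' < qlow" "isCont F q'" by (rule \<nu>.continuity_point_between)
  have "\<forall>\<^sub>F i in sequentially. hits (\<lambda>i. Acc i \<and> Low i \<le> q') i / num i < r"
    using empirical_cdf[OF q'(3)] F_less_qlow[OF q'(2)] by (rule order_tendstoD)
  moreover have "\<forall>\<^sub>F t in sequentially. 0 < num t" using num_at_top by (simp add: filterlim_at_top_dense)
  ultimately show ?thesis
  proof eventually_elim
    case (elim i)
    then have "\<not> Bar_le q' i" by (simp add: bar_le_iff field_simps)
    then show ?case using bar_le_mono q' by (metis less_imp_le)
  qed
qed

lemma eventually_bar: "qhigh < q \<Longrightarrow> \<forall>\<^sub>F i in sequentially. Bar_le q i"
proof -
  assume "qhigh < q"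
  then obtain q' where q': "qhigh < q'" "q' < q" "isCont F q'" by (rule \<nu>.continuity_point_between)
  have "\<forall>\<^sub>F i in sequentially. r < hits (\<lambda>i. Acc i \<and> Low i \<le> q') i / num i"
    using empirical_cdf[OF q'(3)] F_above_qhigh[OF q'(1)] by (rule order_tendstoD)
  moreover have "\<forall>\<^sub>F t in sequentially. 0 < num t" using num_at_top by (simp add: filterlim_at_top_dense)
  ultimately show ?thesis
  proof eventually_elim
    case (elim i)
    then have "Bar_le q' i" by (simp add: bar_le_iff field_simps)
    then show ?case using bar_le_mono q' by (metis less_imp_le)
  qed
qed

lemma F_eq_1_if_all_below:
  assumes "\<And>i. Low i \<le> q" "isCont F q"
  shows "F q = 1"
proof -
  have "\<forall>\<^sub>F t in sequentially. 0 < num t" using num_at_top by (simp add: filterlim_at_top_dense)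
  then have "\<forall>\<^sub>F t in sequentially. hits (\<lambda>i. Acc i \<and> Low i \<le> q) t / num t = 1"
    by eventually_elim (simp add: assms(1))
  then have "(\<lambda>t. hits (\<lambda>i. Acc i \<and> Low i \<le> q) t / num t) \<longlonglongrightarrow> 1" by (rule tendsto_eventually)
  with empirical_cdf[OF assms(2)] show ?thesis by (rule LIMSEQ_unique)
qed

lemma qhigh_le_mu_max: "ereal qhigh \<le> mu_max \<mu>"
proof (rule ccontr)
  assume "\<not> ereal qhigh \<le> mu_max \<mu>"
  then have "mu_max \<mu> < ereal qhigh" by simp
  then obtain s where s: "mu_max \<mu> < ereal s" "ereal s < ereal qhigh" using ereal_dense2 by blast
  then obtain q where q: "s < q" "q < qhigh" "isCont F q" using \<nu>.continuity_point_between[of s qhigh] by auto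
  have "Low i \<le> q" for i
  proof -
    have "ereal (Low i) < ereal s" using Low_below[of i] s(1) by (rule less_trans)
    then show ?thesis using q(1) by simp
  qed
  then have "F q = 1" using q by (intro F_eq_1_if_all_below)
  then show False using F_less_qhigh[OF q(2)] r by simp
qed

section \<open>Support points inside the quantile interval\<close>

lemma selected_frequency_mid:
  assumes "q \<in> \<rat>" "c \<in> \<rat>" "H \<in> {Bar_le q, \<lambda>i. \<not> Bar_le q i}" "filterlim (hits H) at_top sequentially"
  shows "(\<lambda>t. hits (\<lambda>i. H i \<and> c \<le> Mid i) t / hits H t) \<longlonglongrightarrow> P c"
  using selected_frequency[OF assms(1,2) _ assms(3,4), of UNIV] by simp

lemma acceptI: "Bar_le q i \<Longrightarrow> q \<le> Mid i \<Longrightarrow> Acc i"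
  unfolding accept_def by (rule bar_le_mono)

lemma eventually_bar_le_mono: "d \<le> e \<Longrightarrow> \<forall>\<^sub>F i in sequentially. Bar_le d i \<longrightarrow> Bar_le e i"
  using bar_le_mono by (intro always_eventually) blast

text \<open>
  While the bar is at or below a level \<open>z'\<close> slightly above \<open>z\<close>, a pair with mean at least \<open>z'\<close> and minimum in
  \<open>(c, z']\<close> occurs with a fixed positive frequency and is admitted. The admitted values in
  \<open>(c, z']\<close> have a vanishing share, as \<open>\<nu>\<close> is flat there, so such steps must be rare.
\<close>
lemma support_point_bar_rare:
  assumes z: "z \<in> measure_support \<mu>" "qlow < z" "z < qhigh"
  shows "rare (Bar_le z) num"
proof -
  \<comment> \<open>\<open>c\<close> and \<open>z'\<close> are so close to \<open>z\<close> that \<open>2 * z' - c < qhigh \<le> mu_max\<close>: partners above \<open>2 * z' - c\<close> exist.\<close>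
  obtain c where c: "c \<in> \<rat>" "max qlow (2 * z - qhigh) < c" "c < z"
    using Rats_dense_in_real[of "max qlow (2 * z - qhigh)" z] z by auto
  obtain z' where z': "z' \<in> \<rat>" "z < z'" "z' < (qhigh + c) / 2"
    using Rats_dense_in_real[of z "(qhigh + c) / 2"] c by (auto simp: field_simps)
  have lt: "z' < qhigh" "c < qhigh" "qlow < c" "qlow < z'" using c z z' by auto
  define W where "W t = hits (\<lambda>i. Acc i \<and> Low i \<le> z') t - hits (\<lambda>i. Acc i \<and> Low i \<le> c) t" for t
  let ?A = "\<lambda>i. Bar_le z' i \<and> z' \<le> Mid i \<and> Low i \<in> {c<..z'}"
  have "rare (Bar_le z') num"
  proof (rule rare_of_drift[OF num_at_top])
    have "(\<lambda>t. hits (\<lambda>i. Acc i \<and> Low i \<le> z') t / num t - hits (\<lambda>i. Acc i \<and> Low i \<le> c) t / num t)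
        \<longlonglongrightarrow> F z' - F c"
      using lt by (intro tendsto_diff empirical_cdf cdf_flat)
    then show "(\<lambda>t. W t / num t) \<longlonglongrightarrow> 0"
      unfolding W_def by (simp add: diff_divide_distrib cdf_flat lt)
    show "(\<lambda>t. hits ?A t / hits (Bar_le z') t) \<longlonglongrightarrow> pass_prob \<mu> z' {c<..z'}"
      if "filterlim (hits (Bar_le z')) at_top sequentially"
      using selected_frequency[OF z'(1) z'(1) _ _ that, of "{c<..z'}"] c(1) z'(1) by simp
    have "2 * z' - c < qhigh" using z'(3) by simp
    then have "ereal (2 * z' - c) < mu_max \<mu>" using qhigh_le_mu_max by (metis ereal_less_eq(3) less_ereal.simps(1) less_le_trans)
    then show "0 < pass_prob \<mu> z' {c<..z'}"
      using z(1) c(3) z'(2) by (rule pass_prob_near_support[rotated 3])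
    show "hits ?A t / hits (Bar_le z') t * hits (Bar_le z') t \<le> \<bar>W t\<bar> + 0" if "0 < hits (Bar_le z') t" for t
    proof -
      have "hits ?A t + hits (\<lambda>i. Acc i \<and> Low i \<le> c) t \<le> hits (\<lambda>i. Acc i \<and> Low i \<le> z') t"
        unfolding hits_def sum.distrib[symmetric]
        using lt c(3) z'(2) by (intro sum_mono) (auto dest: acceptI)
      then show ?thesis using that unfolding W_def by simp
    qed
  qed
  then show ?thesis
    by (rule rare_mono[OF num_at_top _ eventually_bar_le_mono]) (use z'(2) in simp)
qed

lemma Bar_le_transfer:
  assumes "\<And>j. Low j \<le> d \<Longrightarrow> Low j \<le> e" "Bar_le d i"
  shows "Bar_le e i"
proof -
  have "hits (\<lambda>j. Acc j \<and> Low j \<le> d) i \<le> hits (\<lambda>j. Acc j \<and> Low j \<le> e) i"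
    using assms(1) by (intro hits_mono) auto
  then show ?thesis using assms(2) by (simp add: bar_le_iff)
qed

text \<open>
  All admitted values are support points, so between support points the level \<open>d\<close> can be lowered
  to the largest support point below it without affecting the comparison with the bar.
\<close>
lemma bar_rare_below_qhigh:
  assumes "qlow = qhigh \<or> (\<exists>z\<in>measure_support \<mu>. qlow < z \<and> z < qhigh)" and d: "d < qhigh"
  shows "rare (Bar_le d) num"
  using assms(1)
proof
  assume "qlow = qhigh"
  then show ?thesis using d by (intro rare_eventually_not[OF num_at_top] eventually_not_bar) simp
next
  assume "\<exists>z\<in>measure_support \<mu>. qlow < z \<and> z < qhigh"
  then obtain z0 where z0: "z0 \<in> measure_support \<mu>" "qlow < z0" "z0 < qhigh" by blast
  show ?thesis
  proof (cases "d \<le> z0")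
    case True
    then show ?thesis
      by (rule rare_mono[OF num_at_top support_point_bar_rare[OF z0] eventually_bar_le_mono])
  next
    case False
    let ?K = "measure_support \<mu> \<inter> {z0..d}"
    have "compact ?K" by (intro closed_Int_compact closed_measure_support compact_Icc)
    moreover have "z0 \<in> ?K" using z0 False by auto
    ultimately obtain z where z: "z \<in> ?K" "\<And>s. s \<in> ?K \<Longrightarrow> s \<le> z"
      using compact_attains_sup[of ?K] by blast
    have "Low j \<le> z" if "Low j \<le> d" for j
      using z that Low_support[of j] by (cases "z0 \<le> Low j") auto
    then have "\<forall>\<^sub>F i in sequentially. Bar_le d i \<longrightarrow> Bar_le z i"
      using Bar_le_transfer by (intro always_eventually) blast
    moreover have "rare (Bar_le z) num"
      using z z0 d by (intro support_point_bar_rare) auto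
    ultimately show ?thesis using rare_mono[OF num_at_top] by blast
  qed
qed

section \<open>The limit when the bar approaches the maximum\<close>

text \<open>
  An admitted pair with minimum at most \<open>c'\<close> has mean below the midpoint of \<open>c'\<close> and \<open>mu_max\<close>, so the
  bar was below that midpoint, which is rare on the scale of admissions.
\<close>
lemma limit_at_mu_max:
  assumes max: "mu_max \<mu> = ereal qhigh" and sp: "\<And>d. d < qhigh \<Longrightarrow> rare (Bar_le d) num"
  shows "\<nu> = return borel qhigh"
proof (rule cdf_unique)
  show "real_distribution (return borel qhigh :: real measure)"
    by (intro real_distribution.intro real_distribution_axioms.intro prob_space_return) auto
  have below: "F c = 0" if c: "c < qhigh" for c
  proof -
    obtain c' where c': "c < c'" "c' < qhigh" "isCont F c'" using \<nu>.continuity_point_between[OF c] .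
    have "rare (\<lambda>i. Acc i \<and> Low i \<le> c') num"
    proof (rule rare_mono[OF num_at_top sp[of "(c' + qhigh) / 2"]])
      have "Bar_le ((c' + qhigh) / 2) i" if "Acc i" "Low i \<le> c'" for i
      proof -
        have "x (Suc i) < qhigh" "y (Suc i) < qhigh" using points(3,4)[of i] max by auto
        then have "Mid i \<le> (c' + qhigh) / 2" using that(2) by (auto simp: mid_def low_def min_def split: if_splits)
        then show ?thesis using that(1) bar_le_mono unfolding accept_def by blast
      qed
      then show "\<forall>\<^sub>F i in sequentially. Acc i \<and> Low i \<le> c' \<longrightarrow> Bar_le ((c' + qhigh) / 2) i" by simp
    qed (use c' in simp)
    then have "F c' = 0" using empirical_cdf[OF c'(3)] unfolding rare_def by (auto dest: LIMSEQ_unique)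
    then show ?thesis using \<nu>.cdf_nondecreasing[of c c'] \<nu>.cdf_nonneg[of c] c' by simp
  qed
  have above: "F u = 1" if u: "qhigh < u" for u
  proof -
    obtain q where q: "qhigh < q" "q < u" "isCont F q" using \<nu>.continuity_point_between[OF u] .
    have "Low i \<le> q" for i using Low_below[of i] max q by simp
    then have "F q = 1" using q by (intro F_eq_1_if_all_below)
    then show ?thesis using \<nu>.cdf_nondecreasing[of q u] \<nu>.cdf_bounded_prob[of u] q by simp
  qed
  have "F qhigh = 1"
  proof (rule tendsto_unique[of "at_right qhigh" F])
    show "(F \<longlongrightarrow> F qhigh) (at_right qhigh)"
      using \<nu>.cdf_is_right_cont[of qhigh] by (simp add: continuous_within)
    show "(F \<longlongrightarrow> 1) (at_right qhigh)"
      by (rule tendsto_eventually, rule eventually_mono[OF eventually_at_right_less]) (rule above)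
  qed simp
  then show "F = cdf (return borel qhigh)"
    using below above by (auto simp: fun_eq_iff cdf_def measure_return indicator_def not_le less_le)
qed (rule limit)

section \<open>The limit when the decisions stabilise\<close>

text \<open>
  Sufficient for acceptance to agree with the fixed bar \<open>m\<close>: the actual bar lies in
  \<open>[m1, m2]\<close> up to rare steps, and means between \<open>m1\<close> and \<open>m2\<close> have probability zero. With
  \<open>m1 = m = m2\<close> this treats a bar that tends to \<open>m\<close> off rare steps; the general form covers a bar that keeps
  oscillating across a gap.
\<close>
lemma disagreement_rare:
  assumes m: "m1 \<le> m" "m \<le> m2" "P m1 = P m2"
    and low: "\<And>d. d < m1 \<Longrightarrow> rare (Bar_le d) num"
    and high: "\<And>d. m2 < d \<Longrightarrow> rare (\<lambda>i. \<not> Bar_le d i) num"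
  shows "rare (\<lambda>i. Acc i \<noteq> (m \<le> Mid i)) real"
  unfolding rare_def
proof (rule order_tendstoI)
  fix l :: real assume "l < 0"
  then show "\<forall>\<^sub>F t in sequentially. l < hits (\<lambda>i. Acc i \<noteq> (m \<le> Mid i)) t / real t"
    by (simp add: less_le_trans[of l 0])
next
  fix e :: real assume e: "0 < e"
  \<comment> \<open>A disagreement needs a bar outside \<open>[d, d']\<close> or a mean in \<open>[d, d')\<close>, and the latter has
    probability below \<open>e\<close>.\<close>
  obtain d where d: "d \<in> \<rat>" "d < m1" "P d < P m1 + e / 2"
    using rational_below[OF isCont_pass_prob, of "{..<P m1 + e / 2}" m1 "m1 - 1"] e by auto
  obtain d' where d': "d' \<in> \<rat>" "m2 < d'" "P m2 - e / 2 < P d'"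
    using rational_above[OF isCont_pass_prob, of "{P m2 - e / 2<..}" m2 "m2 + 1"] e by auto
  let ?b = "\<lambda>t. hits (Bar_le d) t / real t + hits (\<lambda>i. \<not> Bar_le d' i) t / real t
      + (hits (\<lambda>i. d \<le> Mid i) t / real t - hits (\<lambda>i. d' \<le> Mid i) t / real t)"
  have "?b \<longlonglongrightarrow> 0 + 0 + (P d - P d')"
    using rare_time[OF low[OF d(2)]] rare_time[OF high[OF d'(2)]]
      time_frequency[OF d(1), of UNIV] time_frequency[OF d'(1), of UNIV]
    unfolding rare_def by (intro tendsto_add tendsto_diff) simp_all
  then have "\<forall>\<^sub>F t in sequentially. ?b t < e"
    using d(3) d'(3) m(3) by (intro order_tendstoD(2)) auto
  moreover have "hits (\<lambda>i. Acc i \<noteq> (m \<le> Mid i)) t / real t \<le> ?b t" for t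
  proof -
    have "hits (\<lambda>i. Acc i \<noteq> (m \<le> Mid i)) t + hits (\<lambda>i. d' \<le> Mid i) t
        \<le> hits (Bar_le d) t + hits (\<lambda>i. \<not> Bar_le d' i) t + hits (\<lambda>i. d \<le> Mid i) t"
      unfolding hits_def sum.distrib[symmetric]
    proof (rule sum_mono)
      fix i
      have "Bar_le d i" if "Acc i" "Mid i < d"
        using that bar_le_mono[of r x y "Mid i" i d] unfolding accept_def by simp
      moreover have "\<not> Bar_le d' i" if "\<not> Acc i" "d' \<le> Mid i" using that acceptI by blast
      ultimately show "(of_bool (Acc i \<noteq> (m \<le> Mid i)) + of_bool (d' \<le> Mid i) :: real)
          \<le> of_bool (Bar_le d i) + of_bool (\<not> Bar_le d' i) + of_bool (d \<le> Mid i)"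
        using d(2) d'(2) m(1,2) by (auto simp: of_bool_def)
    qed
    then show ?thesis
      by (simp add: divide_right_mono flip: add_divide_distrib diff_divide_distrib)
  qed
  ultimately show "\<forall>\<^sub>F t in sequentially. hits (\<lambda>i. Acc i \<noteq> (m \<le> Mid i)) t / real t < e"
    by (elim eventually_mono) (rule le_less_trans)
qed

text \<open>
  The assumed frequencies concern rational levels. Monotonicity in the level and continuity of the
  probability extend them to all real levels, in particular to those that depend on the path.
\<close>
lemma time_frequency_real:
  assumes "U \<in> test_sets"
  shows "(\<lambda>t. hits (\<lambda>i. m \<le> Mid i \<and> Low i \<in> U) t / real t) \<longlonglongrightarrow> pass_prob \<mu> m U"
proof (rule order_tendstoI)
  note U = test_sets_borel[OF assms]
  fix l assume l: "l < pass_prob \<mu> m U"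
  obtain d where d: "d \<in> \<rat>" "m < d" "P m - (pass_prob \<mu> m U - l) < P d"
    using rational_above[OF isCont_pass_prob, of "{P m - (pass_prob \<mu> m U - l)<..}" m "m + 1"] l by auto
  have "l < pass_prob \<mu> d U" using pass_prob_diff_le[of m d U] d U by simp
  then have "\<forall>\<^sub>F t in sequentially. l < hits (\<lambda>i. d \<le> Mid i \<and> Low i \<in> U) t / real t"
    by (rule order_tendstoD(1)[OF time_frequency[OF d(1) assms]])
  then show "\<forall>\<^sub>F t in sequentially. l < hits (\<lambda>i. m \<le> Mid i \<and> Low i \<in> U) t / real t"
    by (rule eventually_mono) (use d(2) in \<open>auto elim!: less_le_trans intro!: divide_right_mono hits_mono\<close>)
next
  note U = test_sets_borel[OF assms]
  fix u assume u: "pass_prob \<mu> m U < u"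
  obtain d where d: "d \<in> \<rat>" "d < m" "P d < P m + (u - pass_prob \<mu> m U)"
    using rational_below[OF isCont_pass_prob, of "{..<P m + (u - pass_prob \<mu> m U)}" m "m - 1"] u by auto
  have "pass_prob \<mu> d U < u" using pass_prob_diff_le[of d m U] d U by simp
  then have "\<forall>\<^sub>F t in sequentially. hits (\<lambda>i. d \<le> Mid i \<and> Low i \<in> U) t / real t < u"
    by (rule order_tendstoD(2)[OF time_frequency[OF d(1) assms]])
  then show "\<forall>\<^sub>F t in sequentially. hits (\<lambda>i. m \<le> Mid i \<and> Low i \<in> U) t / real t < u"
    by (rule eventually_mono) (use d(2) in \<open>auto elim!: le_less_trans[rotated] intro!: divide_right_mono hits_mono\<close>)
qed

text \<open>
  Numerator and denominator of the empirical distribution function are counts of admissions, which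
  differ from the counts of pairs with mean at least \<open>m\<close> by a negligible number of steps. Continuity of
  the limit law turns \<open>qlow \<le> m \<le> qhigh\<close> into the exact quantile equation.
\<close>
lemma limit_law:
  assumes sp: "rare (\<lambda>i. Acc i \<noteq> (m \<le> Mid i)) real"
    and m: "ereal m < mu_max \<mu>" "qlow \<le> m" "m \<le> qhigh"
  shows "rho \<mu> r m = 0"
    and "\<nu> = density \<mu> (\<lambda>x. ennreal (2 / P m * measure \<mu> ({x..} \<inter> {2 * m - x..})))"
proof -
  define L where "L = density \<mu> (\<lambda>x. ennreal (2 / P m * measure \<mu> ({x..} \<inter> {2 * m - x..})))"
  have pos: "0 < P m" by (rule pass_prob_positive[OF m(1)])
  note L = pass_law[OF m(1), folded L_def]
  have acc: "(\<lambda>t. hits (\<lambda>i. Acc i \<and> Low i \<in> U) t / real t) \<longlonglongrightarrow> pass_prob \<mu> m U" if "U \<in> test_sets" for U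
  proof -
    let ?D = "\<lambda>t. hits (\<lambda>i. Acc i \<noteq> (m \<le> Mid i)) t / real t"
    let ?f = "\<lambda>t. hits (\<lambda>i. m \<le> Mid i \<and> Low i \<in> U) t / real t"
    have D: "?D \<longlonglongrightarrow> 0" using sp by (simp add: rare_def)
    note f = time_frequency_real[OF that, of m]
    show ?thesis
    proof (rule tendsto_sandwich)
      show "(\<lambda>t. ?f t - ?D t) \<longlonglongrightarrow> pass_prob \<mu> m U" using tendsto_diff[OF f D] by simp
      show "(\<lambda>t. ?f t + ?D t) \<longlonglongrightarrow> pass_prob \<mu> m U" using tendsto_add[OF f D] by simp
      have "hits (\<lambda>i. m \<le> Mid i \<and> Low i \<in> U) t \<le>
          hits (\<lambda>i. Acc i \<and> Low i \<in> U) t + hits (\<lambda>i. Acc i \<noteq> (m \<le> Mid i)) t" for t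
        by (rule hits_le_add) auto
      then show "\<forall>\<^sub>F t in sequentially. ?f t - ?D t \<le> hits (\<lambda>i. Acc i \<and> Low i \<in> U) t / real t"
        by (intro always_eventually) (simp add: divide_right_mono diff_le_eq flip: diff_divide_distrib)
      have "hits (\<lambda>i. Acc i \<and> Low i \<in> U) t \<le>
          hits (\<lambda>i. m \<le> Mid i \<and> Low i \<in> U) t + hits (\<lambda>i. Acc i \<noteq> (m \<le> Mid i)) t" for t
        by (rule hits_le_add) auto
      then show "\<forall>\<^sub>F t in sequentially. hits (\<lambda>i. Acc i \<and> Low i \<in> U) t / real t \<le> ?f t + ?D t"
        by (intro always_eventually) (simp add: divide_right_mono flip: add_divide_distrib)
    qed
  qed
  have quot: "(\<lambda>t. hits (\<lambda>i. Acc i \<and> Low i \<le> u) t / num t) \<longlonglongrightarrow> cdf L u" if "u \<in> \<rat>" for u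
  proof -
    have "(\<lambda>t. (hits (\<lambda>i. Acc i \<and> Low i \<in> {..u}) t / real t) / (hits (\<lambda>i. Acc i \<and> Low i \<in> UNIV) t / real t))
        \<longlonglongrightarrow> pass_prob \<mu> m {..u} / P m"
      using that pos by (intro tendsto_divide acc) auto
    moreover have "\<forall>\<^sub>F t in sequentially.
        (hits (\<lambda>i. Acc i \<and> Low i \<in> {..u}) t / real t) / (hits (\<lambda>i. Acc i \<and> Low i \<in> UNIV) t / real t)
        = hits (\<lambda>i. Acc i \<and> Low i \<le> u) t / num t"
      using eventually_gt_at_top[of 0] by eventually_elim simp
    ultimately show ?thesis unfolding L(2) by (rule Lim_transform_eventually)
  qed
  interpret L: real_distribution L by (rule L(1))
  have F_eq: "F u = cdf L u" for u
  proof (rule antisym)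
    show "F u \<le> cdf L u"
    proof (rule ccontr)
      assume "\<not> F u \<le> cdf L u"
      then obtain u' where u': "u' \<in> \<rat>" "u < u'" "cdf L u' < F u"
        using rational_above[OF L(3), of "{..<F u}" u "u + 1"] by auto
      obtain q where q: "u < q" "q < u'" "isCont F q" using \<nu>.continuity_point_between[OF u'(2)] .
      have "F q \<le> cdf L u'"
        using empirical_cdf[OF q(3)] quot[OF u'(1)] q(2)
        by (intro LIMSEQ_le[of _ _ "\<lambda>t. hits (\<lambda>i. Acc i \<and> Low i \<le> u') t / num t"] exI[of _ 0])
           (auto intro!: divide_right_mono hits_mono)
      then show False using u'(3) q \<nu>.cdf_nondecreasing[of u q] by simp
    qed
    show "cdf L u \<le> F u"
    proof (rule ccontr)
      assume "\<not> cdf L u \<le> F u"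
      then obtain u' where u': "u' \<in> \<rat>" "u' < u" "F u < cdf L u'"
        using rational_below[OF L(3), of "{F u<..}" u "u - 1"] by auto
      obtain q where q: "u' < q" "q < u" "isCont F q" using \<nu>.continuity_point_between[OF u'(2)] .
      have "cdf L u' \<le> F q"
        using empirical_cdf[OF q(3)] quot[OF u'(1)] q(1)
        by (intro LIMSEQ_le[of "\<lambda>t. hits (\<lambda>i. Acc i \<and> Low i \<le> u') t / num t"] exI[of _ 0])
           (auto intro!: divide_right_mono hits_mono)
      then show False using u'(3) q \<nu>.cdf_nondecreasing[of q u] by simp
    qed
  qed
  then have "F = cdf L" by auto
  then show "\<nu> = L" using cdf_unique[OF limit L(1)] by simp
  have cont: "isCont F m" using L(3) \<open>F = cdf L\<close> by simp
  have "F m = r"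
  proof (rule antisym)
    show "F m \<le> r"
    proof (rule ccontr)
      assume "\<not> F m \<le> r"
      then obtain d where "d < m" "r < F d" using rational_below[OF cont, of "{r<..}" "m - 1"] by auto
      then show False using F_less_qhigh[of d] m by simp
    qed
    show "r \<le> F m"
    proof (rule ccontr)
      assume "\<not> r \<le> F m"
      then obtain d where "m < d" "F d < r" using rational_above[OF cont, of "{..<r}" "m + 1"] by auto
      then show False using F_above_qlow[of d] m by simp
    qed
  qed
  moreover have "pass_prob \<mu> m {..m} = P m - (measure \<mu> {m<..})\<^sup>2"
    using pass_prob_split[of m m] pass_prob_tail[of m m] by simp
  ultimately have "(P m - (measure \<mu> {m<..})\<^sup>2) / P m = r" using F_eq[of m] L(2)[of m] by simp
  then have "(measure \<mu> {m<..})\<^sup>2 / P m = 1 - r" using pos by (simp add: field_simps)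
  then show "rho \<mu> r m = 0" by (simp add: rho_def pass_prob_UNIV)
qed

section \<open>A gap of the support inside the quantile interval\<close>

text \<open>
  Here \<open>W\<close> is nonnegative exactly when the bar is at the lower end. The increments of \<open>W\<close> add up to
  \<open>V (Bar_le q)\<close> over the steps with the bar low and to \<open>V ?HI\<close> over those with the bar high. As
  \<open>\<bar>W\<bar>\<close> grows at least by the increment times the current sign, the difference of these two sums is
  at most \<open>\<bar>W\<bar>\<close>, while their sum is \<open>W\<close>; hence \<open>\<bar>W\<bar>\<close> bounds the first one and the negative of the second
  one. With the bar at \<open>m\<close>, the increments average to \<open>(1 - r) * P m - u\<close> per step, where \<open>u\<close> is the
  probability that both values exceed the gap.
\<close>
lemma threshold_across_gap:
  assumes ab: "qlow < qhigh" and gap: "\<And>z. z \<in> measure_support \<mu> \<Longrightarrow> qlow < z \<Longrightarrow> qhigh \<le> z"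
  shows "ereal qhigh < mu_max \<mu>"
    and "\<exists>m\<ge>qlow. m \<le> qhigh \<and> rare (\<lambda>i. Acc i \<noteq> (m \<le> Mid i)) real"
proof -
  obtain q where q: "q \<in> \<rat>" "qlow < q" "q < qhigh" using Rats_dense_in_real[OF ab] by auto
  show "ereal qhigh < mu_max \<mu>"
  proof (rule ccontr)
    assume "\<not> ereal qhigh < mu_max \<mu>"
    then have "mu_max \<mu> = ereal qhigh" using qhigh_le_mu_max by (simp add: not_less)
    then have "Low i \<le> q" for i
      using gap[OF Low_support[of i]] Low_below[of i] q by (cases "qlow < Low i") auto
    then have "F q = 1" using q by (intro F_eq_1_if_all_below cdf_flat)
    then show False using cdf_flat q r by simp
  qed
  have same: "Bar_le d i \<longleftrightarrow> Bar_le q i" if "qlow \<le> d" "d < qhigh" for d i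
  proof -
    have "Low j \<le> d \<longleftrightarrow> Low j \<le> q" for j
      using gap[OF Low_support[of j]] that q by (cases "qlow < Low j") auto
    then show ?thesis using Bar_le_transfer[of d q i] Bar_le_transfer[of q d i] by blast
  qed
  define W where "W t = hits (\<lambda>i. Acc i \<and> Low i \<le> q) t - r * num t" for t
  define V where "V H t = (1 - r) * hits (\<lambda>i. H i \<and> Acc i) t - hits (\<lambda>i. H i \<and> Acc i \<and> q < Low i) t" for H t
  let ?HI = "\<lambda>i. \<not> Bar_le q i"
  have LO_iff: "Bar_le q t \<longleftrightarrow> 0 \<le> W t" for t by (simp add: bar_le_iff W_def)
  have VW: "W t = V (Bar_le q) t + V ?HI t \<and> V (Bar_le q) t - V ?HI t \<le> \<bar>W t\<bar>" for t
  proof (induction t)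
    case 0
    show ?case by (simp add: W_def V_def)
  next
    case (Suc t)
    define w where "w = of_bool (Acc t \<and> Low t \<le> q) - r * of_bool (Acc t)"
    have "W (Suc t) = W t + w" by (simp add: W_def w_def algebra_simps)
    moreover have "V (Bar_le q) (Suc t) = V (Bar_le q) t + (if Bar_le q t then w else 0)"
      by (auto simp: V_def w_def algebra_simps of_bool_def)
    moreover have "V ?HI (Suc t) = V ?HI t + (if Bar_le q t then 0 else w)"
      by (auto simp: V_def w_def algebra_simps of_bool_def)
    ultimately show ?case using Suc.IH LO_iff[of t] by (auto split: if_splits)
  qed
  then have V_LO: "V (Bar_le q) t \<le> \<bar>W t\<bar>" and V_HI: "- V ?HI t \<le> \<bar>W t\<bar>" for t
    by (smt (verit))+
  have Wlim: "(\<lambda>t. W t / num t) \<longlonglongrightarrow> 0"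
  proof -
    have "(\<lambda>t. hits (\<lambda>i. Acc i \<and> Low i \<le> q) t / num t - r) \<longlonglongrightarrow> F q - r"
      using q by (intro tendsto_diff empirical_cdf cdf_flat tendsto_const)
    moreover have "\<forall>\<^sub>F t in sequentially. 0 < num t" using num_at_top by (simp add: filterlim_at_top_dense)
    then have "\<forall>\<^sub>F t in sequentially. hits (\<lambda>i. Acc i \<and> Low i \<le> q) t / num t - r = W t / num t"
      by eventually_elim (simp add: W_def field_simps)
    ultimately show ?thesis using q by (simp add: cdf_flat Lim_transform_eventually)
  qed
  have clear: "(a * (v / h) - w / h) * h = a * v - w" and clear': "(w / h - a * (v / h)) * h = w - a * v"
    if "0 < h" for a v w h :: real using that by (simp_all add: field_simps)
  define u where "u = (measure \<mu> {q<..})\<^sup>2"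
  have P_mono: "P qhigh \<le> P qlow" using ab by (intro pass_prob_mono) auto
  consider (A) "u < (1 - r) * P qlow" | (B) "(1 - r) * P qhigh < u"
    | (C) "(1 - r) * P qlow \<le> u" "u \<le> (1 - r) * P qhigh" by linarith
  \<comment> \<open>(A): drift away from zero while the bar is low, so it is high except at rare steps.
    (B): drift away from zero while the bar is high, so it is low except at rare steps.
    (C): both drifts vanish, since the drift at \<open>qlow\<close> is the larger one.\<close>
  then show "\<exists>m\<ge>qlow. m \<le> qhigh \<and> rare (\<lambda>i. Acc i \<noteq> (m \<le> Mid i)) real"
  proof cases
    case A
    obtain c where c: "c \<in> \<rat>" "qlow < c" "c < q" "u / (1 - r) < P c"
      using rational_above[OF isCont_pass_prob, of "{u / (1 - r)<..}" qlow q] A q r by (auto simp: field_simps)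
    let ?X = "\<lambda>t. (1 - r) * (hits (\<lambda>i. Bar_le q i \<and> c \<le> Mid i) t / hits (Bar_le q) t)
        - hits (\<lambda>i. Bar_le q i \<and> q \<le> Mid i \<and> Low i \<in> {q<..}) t / hits (Bar_le q) t"
    have sp: "rare (Bar_le q) num"
    proof (rule rare_of_drift[OF num_at_top Wlim])
      show "?X \<longlonglongrightarrow> (1 - r) * P c - u" if "filterlim (hits (Bar_le q)) at_top sequentially"
        unfolding u_def pass_prob_tail[OF order_refl, of q, symmetric]
        using that q(1) c(1) by (intro tendsto_diff tendsto_mult tendsto_const selected_frequency_mid selected_frequency) auto
      show "0 < (1 - r) * P c - u" using c(4) r by (simp add: field_simps)
      show "?X t * hits (Bar_le q) t \<le> \<bar>W t\<bar> + 0" if pos: "0 < hits (Bar_le q) t" for t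
      proof -
        have "hits (\<lambda>i. Bar_le q i \<and> c \<le> Mid i) t \<le> hits (\<lambda>i. Bar_le q i \<and> Acc i) t"
          using same[of c] c q by (intro hits_mono) (auto dest: acceptI)
        then have "(1 - r) * hits (\<lambda>i. Bar_le q i \<and> c \<le> Mid i) t \<le> (1 - r) * hits (\<lambda>i. Bar_le q i \<and> Acc i) t"
          using r by (intro mult_left_mono) auto
        moreover have "hits (\<lambda>i. Bar_le q i \<and> Acc i \<and> q < Low i) t
            \<le> hits (\<lambda>i. Bar_le q i \<and> q \<le> Mid i \<and> Low i \<in> {q<..}) t"
          using low_le_mid[of x y] by (intro hits_mono) (force intro: less_imp_le less_le_trans)
        moreover have "?X t * hits (Bar_le q) t = (1 - r) * hits (\<lambda>i. Bar_le q i \<and> c \<le> Mid i) t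
            - hits (\<lambda>i. Bar_le q i \<and> q \<le> Mid i \<and> Low i \<in> {q<..}) t"
          using pos by (rule clear)
        ultimately show ?thesis using V_LO[of t] unfolding V_def by linarith
      qed
    qed
    have "rare (\<lambda>i. Acc i \<noteq> (qhigh \<le> Mid i)) real"
    proof (rule disagreement_rare[OF order_refl order_refl refl])
      fix d assume d: "d < qhigh"
      show "rare (Bar_le d) num"
      proof (cases "qlow \<le> d")
        case True
        then have "Bar_le d = Bar_le q" using same d by auto
        then show ?thesis using sp by simp
      next
        case False
        then show ?thesis by (intro rare_eventually_not[OF num_at_top] eventually_not_bar) simp
      qed
    next
      fix d assume "qhigh < d"
      then show "rare (\<lambda>i. \<not> Bar_le d i) num"
        using eventually_bar by (intro rare_eventually_not[OF num_at_top]) simp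
    qed
    then show ?thesis using ab less_imp_le order_refl by blast
  next
    case B
    have "measure \<mu> {q<..} = measure \<mu> {qhigh<..}"
    proof (rule finite_measure_eq_AE)
      have "AE z in \<mu>. z \<noteq> qhigh" by (rule AE_I'[of "{qhigh}"]) (auto simp: null_sets_def atomless)
      with AE_support show "AE z in \<mu>. (z \<in> {q<..}) = (z \<in> {qhigh<..})"
        by eventually_elim (use gap q in \<open>force simp: less_le\<close>)
    qed auto
    then have u: "u = (measure \<mu> {qhigh<..})\<^sup>2" by (simp add: u_def)
    obtain c where c: "c \<in> \<rat>" "q < c" "c < qhigh" "P c < u / (1 - r)"
      using rational_below[OF isCont_pass_prob, of "{..<u / (1 - r)}" qhigh q] B q r by (auto simp: field_simps)
    have cu: "(1 - r) * P c < u" using c(4) r by (simp add: field_simps)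
    have "isCont (\<lambda>d. (measure \<mu> {d<..})\<^sup>2) qhigh" by (intro continuous_intros isCont_tail)
    then obtain d where d: "d \<in> \<rat>" "qhigh < d" "(1 - r) * P c < (measure \<mu> {d<..})\<^sup>2"
      using rational_above[of qhigh "\<lambda>d. (measure \<mu> {d<..})\<^sup>2" "{(1 - r) * P c<..}" "qhigh + 1"] cu u by auto
    let ?E = "\<lambda>i. ?HI i \<and> d \<le> Mid i \<and> Low i \<in> {d<..}"
    have "\<forall>\<^sub>F i in sequentially. ?E i \<longrightarrow> ?HI i \<and> Acc i \<and> q < Low i"
      using eventually_bar[OF d(2)] by eventually_elim (use d q in \<open>auto dest: acceptI\<close>)
    from hits_eventually_le[OF this] obtain C where
      C: "\<And>t. hits ?E t \<le> hits (\<lambda>i. ?HI i \<and> Acc i \<and> q < Low i) t + C" by blast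
    let ?X = "\<lambda>t. hits ?E t / hits ?HI t - (1 - r) * (hits (\<lambda>i. ?HI i \<and> c \<le> Mid i) t / hits ?HI t)"
    have sp: "rare ?HI num"
    proof (rule rare_of_drift[OF num_at_top Wlim])
      show "?X \<longlonglongrightarrow> (measure \<mu> {d<..})\<^sup>2 - (1 - r) * P c" if "filterlim (hits ?HI) at_top sequentially"
        unfolding pass_prob_tail[OF order_refl, of d, symmetric]
        using that q(1) c(1) d(1) by (intro tendsto_diff tendsto_mult tendsto_const selected_frequency_mid selected_frequency) auto
      show "0 < (measure \<mu> {d<..})\<^sup>2 - (1 - r) * P c" using d(3) by simp
      show "?X t * hits ?HI t \<le> \<bar>W t\<bar> + C" if pos: "0 < hits ?HI t" for t
      proof -
        have "c \<le> Mid i" if "?HI i" "Acc i" for i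
        proof (rule ccontr)
          assume "\<not> c \<le> Mid i"
          then have "Bar_le c i" using that(2) bar_le_mono[of r x y "Mid i" i c] unfolding accept_def by simp
          then show False using same[of c i] c q that(1) by simp
        qed
        then have "hits (\<lambda>i. ?HI i \<and> Acc i) t \<le> hits (\<lambda>i. ?HI i \<and> c \<le> Mid i) t"
          by (intro hits_mono) auto
        then have "(1 - r) * hits (\<lambda>i. ?HI i \<and> Acc i) t \<le> (1 - r) * hits (\<lambda>i. ?HI i \<and> c \<le> Mid i) t"
          using r by (intro mult_left_mono) auto
        moreover have "?X t * hits ?HI t = hits ?E t - (1 - r) * hits (\<lambda>i. ?HI i \<and> c \<le> Mid i) t"
          using pos by (rule clear')
        ultimately show ?thesis using V_HI[of t] C[of t] unfolding V_def by linarith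
      qed
    qed
    have "rare (\<lambda>i. Acc i \<noteq> (qlow \<le> Mid i)) real"
    proof (rule disagreement_rare[OF order_refl order_refl refl])
      fix d assume "d < qlow"
      then show "rare (Bar_le d) num"
        by (intro rare_eventually_not[OF num_at_top] eventually_not_bar)
    next
      fix d assume d: "qlow < d"
      show "rare (\<lambda>i. \<not> Bar_le d i) num"
      proof (rule rare_mono[OF num_at_top sp], rule always_eventually, intro allI impI notI)
        fix i assume "\<not> Bar_le d i" "Bar_le q i"
        then have "Bar_le qlow i" using same[of qlow i] ab by simp
        then show False using \<open>\<not> Bar_le d i\<close> bar_le_mono[of r x y qlow i d] d by simp
      qed
    qed
    then show ?thesis using ab less_imp_le order_refl by blast
  next
    case C
    then have "(1 - r) * P qlow \<le> (1 - r) * P qhigh" by linarith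
    then have "P qlow = P qhigh" using P_mono r by simp
    then have "rare (\<lambda>i. Acc i \<noteq> (qhigh \<le> Mid i)) real"
    proof (rule disagreement_rare[OF less_imp_le[OF ab] order_refl])
      fix d assume "d < qlow"
      then show "rare (Bar_le d) num"
        by (intro rare_eventually_not[OF num_at_top] eventually_not_bar)
    next
      fix d assume "qhigh < d"
      then show "rare (\<lambda>i. \<not> Bar_le d i) num"
        using eventually_bar by (intro rare_eventually_not[OF num_at_top]) simp
    qed
    then show ?thesis using ab less_imp_le order_refl by blast
  qed
qed

theorem limit_dichotomy:
  "(mu_max \<mu> < \<infinity> \<and> \<nu> = return borel (real_of_ereal (mu_max \<mu>))) \<or>
   (\<exists>m c. ereal m < mu_max \<mu> \<and> rho \<mu> r m = 0 \<and> c > 0 \<and>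
      \<nu> = density \<mu> (\<lambda>x. ennreal (c * measure \<mu> ({x..} \<inter> {2 * m - x..}))))"
proof -
  have conclude: ?thesis
    if "qlow \<le> m" "m \<le> qhigh" "rare (\<lambda>i. Acc i \<noteq> (m \<le> Mid i)) real" "ereal qhigh < mu_max \<mu>" for m
  proof -
    have m: "ereal m < mu_max \<mu>" using that(2,4) by (metis ereal_less_eq(3) le_less_trans)
    have "0 < 2 / P m" using pass_prob_positive[OF m] by simp
    then show ?thesis using limit_law[OF that(3) m that(1,2)] m by blast
  qed
  show ?thesis
  proof (cases "qlow = qhigh \<or> (\<exists>z\<in>measure_support \<mu>. qlow < z \<and> z < qhigh)")
    case True
    note low = bar_rare_below_qhigh[OF True]
    show ?thesis
    proof (cases "ereal qhigh = mu_max \<mu>")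
      case True
      have "\<nu> = return borel qhigh" using True low by (intro limit_at_mu_max) auto
      then show ?thesis using True by (metis PInfty_neq_ereal(1) ereal_infty_less(1) real_of_ereal.simps(1))
    next
      case False
      then have less: "ereal qhigh < mu_max \<mu>" using qhigh_le_mu_max by simp
      have "rare (\<lambda>i. Acc i \<noteq> (qhigh \<le> Mid i)) real"
        by (rule disagreement_rare[OF order_refl order_refl refl low])
           (use eventually_bar in \<open>auto intro: rare_eventually_not[OF num_at_top]\<close>)
      then show ?thesis by (rule conclude[OF qlow_le_qhigh order_refl _ less])
    qed
  next
    case False
    then have "qlow < qhigh" "\<And>z. z \<in> measure_support \<mu> \<Longrightarrow> qlow < z \<Longrightarrow> qhigh \<le> z"
      using qlow_le_qhigh by force+
    from threshold_across_gap[OF this] show ?thesis using conclude by blast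
  qed
qed

end

section \<open>Almost every path is an admission path\<close>

lemma measurable_hits:
  assumes "\<And>i. i < n \<Longrightarrow> Measurable.pred N (\<lambda>\<omega>. Q \<omega> i)"
  shows "(\<lambda>\<omega>. hits (Q \<omega>) n) \<in> borel_measurable N"
  unfolding hits_def of_bool_def using assms by (intro borel_measurable_sum measurable_If) auto

lemma measurable_mid_low:
  assumes "\<forall>k\<in>{1..n}. X k \<in> borel_measurable N \<and> Y k \<in> borel_measurable N" and "i < n"
  shows "(\<lambda>\<omega>. mid (\<lambda>k. X k \<omega>) (\<lambda>k. Y k \<omega>) i) \<in> borel_measurable N"
    and "(\<lambda>\<omega>. low (\<lambda>k. X k \<omega>) (\<lambda>k. Y k \<omega>) i) \<in> borel_measurable N"
  using assms unfolding mid_def low_def by (auto dest!: bspec[of _ _ "Suc i"])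

lemma accept_iff:
  "accept r x y i \<longleftrightarrow>
     r * hits (accept r x y) i \<le> hits (\<lambda>j. accept r x y j \<and> low x y j \<le> mid x y i) i"
  unfolding accept_def[of r x y i] bar_le_iff ..

text \<open>
  The acceptance of step \<open>i\<close> compares values at a random level, so the recursion runs over the
  acceptance indicators of earlier steps instead of over the multiset.
\<close>
lemma measurable_accept:
  assumes XY: "\<forall>k\<in>{1..n}. X k \<in> borel_measurable N \<and> Y k \<in> borel_measurable N"
  shows "i < n \<Longrightarrow> Measurable.pred N (\<lambda>\<omega>. accept r (\<lambda>k. X k \<omega>) (\<lambda>k. Y k \<omega>) i)"
proof (induction i rule: less_induct)
  case (less i)
  note m = measurable_mid_low[OF XY]
  have acc: "Measurable.pred N (\<lambda>\<omega>. accept r (\<lambda>k. X k \<omega>) (\<lambda>k. Y k \<omega>) j)" if "j < i" for j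
    using less that by simp
  have "(\<lambda>\<omega>. hits (accept r (\<lambda>k. X k \<omega>) (\<lambda>k. Y k \<omega>)) i) \<in> borel_measurable N"
    using acc by (intro measurable_hits)
  moreover have "(\<lambda>\<omega>. hits (\<lambda>j. accept r (\<lambda>k. X k \<omega>) (\<lambda>k. Y k \<omega>) j
      \<and> low (\<lambda>k. X k \<omega>) (\<lambda>k. Y k \<omega>) j \<le> mid (\<lambda>k. X k \<omega>) (\<lambda>k. Y k \<omega>) i) i) \<in> borel_measurable N"
  proof (intro measurable_hits)
    fix j assume j: "j < i"
    then have "j < n" using less.prems by simp
    note [measurable] = acc[OF j] m[OF \<open>j < n\<close>] m[OF less.prems]
    show "Measurable.pred N (\<lambda>\<omega>. accept r (\<lambda>k. X k \<omega>) (\<lambda>k. Y k \<omega>) j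
      \<and> low (\<lambda>k. X k \<omega>) (\<lambda>k. Y k \<omega>) j \<le> mid (\<lambda>k. X k \<omega>) (\<lambda>k. Y k \<omega>) i)" by measurable
  qed
  moreover have "(\<lambda>\<omega>. accept r (\<lambda>k. X k \<omega>) (\<lambda>k. Y k \<omega>) i) = (\<lambda>\<omega>. r * hits (accept r (\<lambda>k. X k \<omega>) (\<lambda>k. Y k \<omega>)) i \<le>
      hits (\<lambda>j. accept r (\<lambda>k. X k \<omega>) (\<lambda>k. Y k \<omega>) j
        \<and> low (\<lambda>k. X k \<omega>) (\<lambda>k. Y k \<omega>) j \<le> mid (\<lambda>k. X k \<omega>) (\<lambda>k. Y k \<omega>) i) i)"
    by (rule ext) (rule accept_iff)
  ultimately show ?case by simp
qed

lemma measurable_bar_le: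
  assumes XY: "\<forall>k\<in>{1..n}. X k \<in> borel_measurable N \<and> Y k \<in> borel_measurable N"
  shows "Measurable.pred N (\<lambda>\<omega>. bar_le r (\<lambda>k. X k \<omega>) (\<lambda>k. Y k \<omega>) q n)"
proof -
  have acc: "Measurable.pred N (\<lambda>\<omega>. accept r (\<lambda>k. X k \<omega>) (\<lambda>k. Y k \<omega>) j)" if "j < n" for j
    using measurable_accept[OF XY that] .
  have "(\<lambda>\<omega>. hits (accept r (\<lambda>k. X k \<omega>) (\<lambda>k. Y k \<omega>)) n) \<in> borel_measurable N"
    using acc by (intro measurable_hits)
  moreover have "(\<lambda>\<omega>. hits (\<lambda>j. accept r (\<lambda>k. X k \<omega>) (\<lambda>k. Y k \<omega>) j
      \<and> low (\<lambda>k. X k \<omega>) (\<lambda>k. Y k \<omega>) j \<le> q) n) \<in> borel_measurable N"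
  proof (intro measurable_hits)
    fix j assume j: "j < n"
    note [measurable] = acc[OF j] measurable_mid_low(2)[OF XY j]
    show "Measurable.pred N (\<lambda>\<omega>. accept r (\<lambda>k. X k \<omega>) (\<lambda>k. Y k \<omega>) j
      \<and> low (\<lambda>k. X k \<omega>) (\<lambda>k. Y k \<omega>) j \<le> q)" by measurable
  qed
  ultimately show ?thesis unfolding bar_le_iff by simp
qed

lemma admitted_cong:
  "(\<And>k. 1 \<le> k \<Longrightarrow> k \<le> t \<Longrightarrow> x k = x' k \<and> y k = y' k) \<Longrightarrow> admitted r x y t = admitted r x' y' t"
  by (induction t) (auto simp: Let_def)

text \<open>
  \<open>Q\<close> is the identity, the negation or constantly true: the selections whose frequencies are needed.
\<close>
lemma adapted_bar_le:
  fixes Q :: "bool \<Rightarrow> bool"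
  shows "adapted (borel \<Otimes>\<^sub>M borel) n (\<lambda>z. of_bool (Q (bar_le r (\<lambda>k. fst (z k)) (\<lambda>k. snd (z k)) q n)))"
  unfolding adapted_def
proof (intro conjI allI)
  let ?B = "borel \<Otimes>\<^sub>M borel :: (real \<times> real) measure"
  have bar: "Measurable.pred (PiM {1..n} (\<lambda>_. ?B))
      (\<lambda>z. bar_le r (\<lambda>k. fst (z k)) (\<lambda>k. snd (z k)) q n)"
  proof (rule measurable_bar_le, intro ballI)
    fix k assume "k \<in> {1..n}"
    then have "(\<lambda>z. z k) \<in> measurable (PiM {1..n} (\<lambda>_. ?B)) ?B"
      by (rule measurable_component_singleton)
    note measurable_compose[OF this measurable_fst] measurable_compose[OF this measurable_snd]
    then show "(\<lambda>z. fst (z k)) \<in> borel_measurable (PiM {1..n} (\<lambda>_. ?B))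
        \<and> (\<lambda>z. snd (z k)) \<in> borel_measurable (PiM {1..n} (\<lambda>_. ?B))" ..
  qed
  have "Measurable.pred (PiM {1..n} (\<lambda>_. ?B))
      (\<lambda>z. Q (bar_le r (\<lambda>k. fst (z k)) (\<lambda>k. snd (z k)) q n))"
    by (rule measurable_compose[OF bar]) simp
  then show "(\<lambda>z. of_bool (Q (bar_le r (\<lambda>k. fst (z k)) (\<lambda>k. snd (z k)) q n)))
      \<in> borel_measurable (PiM {1..n} (\<lambda>_. ?B))"
    unfolding of_bool_def by (rule measurable_If[rotated 2, unfolded pred_def[symmetric]]) simp_all
  fix z :: "nat \<Rightarrow> real \<times> real"
  have "admitted r (\<lambda>k. fst (restrict z {1..n} k)) (\<lambda>k. snd (restrict z {1..n} k)) n
      = admitted r (\<lambda>k. fst (z k)) (\<lambda>k. snd (z k)) n"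
    by (rule admitted_cong) simp
  then show "of_bool (Q (bar_le r (\<lambda>k. fst (restrict z {1..n} k)) (\<lambda>k. snd (restrict z {1..n} k)) q n))
      = (of_bool (Q (bar_le r (\<lambda>k. fst (z k)) (\<lambda>k. snd (z k)) q n)) :: real)"
    unfolding bar_le_def by (simp only:)
qed

theorem corollary1p1:
  fixes M :: "'a measure" and X Y :: "nat \<Rightarrow> 'a \<Rightarrow> real"
    and \<mu> :: "real measure" and r :: real and \<nu> :: "'a \<Rightarrow> real measure"
  assumes "real_distribution \<mu>" and "AE x in \<mu>. 0 \<le> x"
    and "\<And>x. emeasure \<mu> {x} = 0"
    and "0 < r" and "r < 1"
    and "prob_space M"
    and "prob_space.indep_vars M (\<lambda>_. borel \<Otimes>\<^sub>M borel) (\<lambda>t \<omega>. (X t \<omega>, Y t \<omega>)) {1..}"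
    and "\<And>t. t \<ge> 1 \<Longrightarrow> prob_space.indep_var M borel (X t) borel (Y t)"
    and "\<And>t. t \<ge> 1 \<Longrightarrow> distr M borel (X t) = \<mu>"
    and "\<And>t. t \<ge> 1 \<Longrightarrow> distr M borel (Y t) = \<mu>"
    and "AE \<omega> in M. real_distribution (\<nu> \<omega>) \<and>
           weak_conv_m
             (\<lambda>t. empirical_measure (admitted r (\<lambda>s. X s \<omega>) (\<lambda>s. Y s \<omega>) (Suc t))) (\<nu> \<omega>)"
  shows "AE \<omega> in M.
           (mu_max \<mu> < \<infinity> \<and> \<nu> \<omega> = return borel (real_of_ereal (mu_max \<mu>))) \<or>
           (\<exists>m c. ereal m < mu_max \<mu> \<and> rho \<mu> r m = 0 \<and> c > 0 \<and>
              \<nu> \<omega> = density \<mu> (\<lambda>x. ennreal (c * measure \<mu> ({x..} \<inter> {2 * m - x..}))))"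
proof -
  interpret prob_space M by (rule assms(6))
  interpret \<mu>: atomless_distribution \<mu>
    by (intro atomless_distribution.intro atomless_distribution_axioms.intro assms(1,3))
  define Z where "Z t \<omega> = (X t \<omega>, Y t \<omega>)" for t \<omega>
  have ind: "indep_vars (\<lambda>_. borel \<Otimes>\<^sub>M borel) Z {1..}" using assms(7) by (simp add: Z_def[abs_def])
  have rvX: "random_variable borel (X t)" and rvY: "random_variable borel (Y t)" if "t \<ge> 1" for t
    using indep_var_rv1[OF assms(8)[OF that]] indep_var_rv2[OF assms(8)[OF that]] by auto
  have distrZ: "distr M (borel \<Otimes>\<^sub>M borel) (Z t) = \<mu> \<Otimes>\<^sub>M \<mu>" if "t \<ge> 1" for t
    using assms(8)[OF that] assms(9,10)[OF that] unfolding indep_var_distribution_eq Z_def[abs_def] by simp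
  have supp: "AE \<omega> in M. \<forall>t\<ge>1. (X t \<omega> \<in> measure_support \<mu> \<and> ereal (X t \<omega>) < mu_max \<mu>)
      \<and> (Y t \<omega> \<in> measure_support \<mu> \<and> ereal (Y t \<omega>) < mu_max \<mu>)"
  proof -
    have "AE \<omega> in M. X t \<omega> \<in> measure_support \<mu> \<and> ereal (X t \<omega>) < mu_max \<mu>" if "t \<ge> 1" for t
      by (rule AE_distrD[OF rvX[OF that]]) (unfold assms(9)[OF that], rule \<mu>.AE_support)
    moreover have "AE \<omega> in M. Y t \<omega> \<in> measure_support \<mu> \<and> ereal (Y t \<omega>) < mu_max \<mu>" if "t \<ge> 1" for t
      by (rule AE_distrD[OF rvY[OF that]]) (unfold assms(10)[OF that], rule \<mu>.AE_support)
    ultimately show ?thesis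
      unfolding AE_all_countable by (intro allI AE_impI AE_conjI) auto
  qed
  define freq where "freq G \<omega> c U \<longleftrightarrow> (filterlim (hits G) at_top sequentially \<longrightarrow>
      (\<lambda>t. hits (\<lambda>i. G i \<and> Z (Suc i) \<omega> \<in> pairs_with c U) t / hits G t) \<longlonglongrightarrow> pass_prob \<mu> c U)" for G \<omega> c U
  have freq_Q: "AE \<omega> in M. freq (\<lambda>i. Q (bar_le r (\<lambda>s. X s \<omega>) (\<lambda>s. Y s \<omega>) q i)) \<omega> c U"
    if "U \<in> test_sets" for Q q c U
    using predictable_selection_law_of_large_numbers[OF ind distrZ adapted_bar_le[of _ Q r q]
        pairs_with_sets[OF test_sets_borel[OF that]], of c]
    by (simp add: freq_def pass_prob_def Z_def)
  have "AE \<omega> in M. \<forall>(Q, q, c, U) \<in> {\<lambda>_. True, \<lambda>b. b, Not} \<times> \<rat> \<times> \<rat> \<times> test_sets.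
      freq (\<lambda>i. Q (bar_le r (\<lambda>s. X s \<omega>) (\<lambda>s. Y s \<omega>) q i)) \<omega> c U"
    by (subst AE_ball_countable)
       (auto intro!: countable_SIGMA countable_rat countable_test_sets freq_Q)
  then show ?thesis using supp assms(11)
  proof eventually_elim
    case (elim \<omega>)
    have fr: "freq (\<lambda>i. Q (bar_le r (\<lambda>s. X s \<omega>) (\<lambda>s. Y s \<omega>) q i)) \<omega> c U"
      if "Q \<in> {\<lambda>_. True, \<lambda>b. b, Not}" "q \<in> \<rat>" "c \<in> \<rat>" "U \<in> test_sets" for Q q c U
    proof -
      have "(Q, q, c, U) \<in> {\<lambda>_. True, \<lambda>b. b, Not} \<times> \<rat> \<times> \<rat> \<times> test_sets"
        using that by (intro SigmaI)
      from bspec[OF elim(1) this] show ?thesis by (simp only: prod.case)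
    qed
    have path_points: "X (Suc i) \<omega> \<in> measure_support \<mu>" "Y (Suc i) \<omega> \<in> measure_support \<mu>"
      "ereal (X (Suc i) \<omega>) < mu_max \<mu>" "ereal (Y (Suc i) \<omega>) < mu_max \<mu>" for i
      using elim(2)[rule_format, of "Suc i"] by simp_all
    note path_limit = conjunct1[OF elim(3)] conjunct2[OF elim(3)]
    interpret admission_path \<mu> r "\<lambda>s. X s \<omega>" "\<lambda>s. Y s \<omega>" "\<nu> \<omega>"
    proof (intro admission_path.intro admission_path_axioms.intro, goal_cases)
      case (8 q c U H)
      then consider "H = (\<lambda>i. True)" | "H = bar_le r (\<lambda>s. X s \<omega>) (\<lambda>s. Y s \<omega>) q"
        | "H = (\<lambda>i. \<not> bar_le r (\<lambda>s. X s \<omega>) (\<lambda>s. Y s \<omega>) q i)" by blast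
      then show ?case
        using fr[of "\<lambda>_. True" q c U] fr[of "\<lambda>b. b" q c U] fr[of Not q c U] 8
        by cases (simp_all add: freq_def Z_def)
    qed (rule \<mu>.atomless_distribution_axioms assms(4,5) path_points path_limit)+
    show ?case by (rule limit_dichotomy)
  qed
qed

end
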